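(* Let $R$ be a P$v$MD. Then: (1) $R$ is a $t\#$-domain if and only if $R\langle X\rangle$ is a $\#$-domain; (2) $R$ is a $t\#\#$-domain if and only if $R\langle X\rangle$ is a $\#\#$-domain; (3) $R$ is a $tRTP$-domain if and only if $R\langle X\rangle$ is an $RTP$-domain.
   Context: $R$ is an integral domain with quotient field $K\neq R$. For nonzero $R$-submodules $A,B$ of $K$, $(A:B)=\{x\in K: xB\subseteq A\}$. For a nonzero fractional ideal $I$, $I_v=(R:(R:I))$, $I_t=\bigcup\{J_v: J\subseteq I\text{ nonzero finitely generated}\}$; $I$ is a $t$-ideal if $I=I_t$; $t$-primes are prime $t$-ideals; $t\text{-Max}(R)$ is the set of ideals maximal among proper $t$-ideals. $R$ is a P$v$MD if $R_M$ is a valuation domain for every $M\in t\text{-Max}(R)$. For $f\in R[X]$, $c(f)$ is the ideal generated by its coefficients; the $t$-Nagata ring is $R\langle X\rangle=R[X]_{N_t}$ with $N_t=\{f\in R[X]: c(f)_t=R\}$. A domain $D$ is a $\#$-domain if $\bigcap_{M\in\mathcal M_1}D_M\neq\bigcap_{M\in\mathcal M_2}D_M$ for any two distinct nonempty sets $\mathcal M_1,\mathcal M_2$ of maximal ideals, and a $\#\#$-domain if every overring is a $\#$-domain. $R$ is a $t\#$-domain if $\bigcap_{M\in\mathcal M_1}R_M\neq\bigcap_{M\in\mathcal M_2}R_M$ for any two distinct subsets of $t\text{-Max}(R)$, and a $t\#\#$-domain if $\bigcap_{P\in\mathcal P_1}R_P\neq\bigcap_{P\in\mathcal P_2}R_P$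 for any two distinct sets $\mathcal P_1,\mathcal P_2$ of pairwise incomparable $t$-primes. $D$ is an $RTP$-domain if for each nonzero ideal $I$, either $I(D:I)=D$ or $I(D:I)$ is a radical ideal; $R$ is a $tRTP$-domain if for each nonzero ideal $I$, either $(I(R:I))_t=R$ or $(I(R:I))_t$ is a radical ideal. *)

theory Defs
  imports "HOL-Computational_Algebra.Polynomial" "HOL-Computational_Algebra.Fraction_Field"
begin

text \<open>Convention: an integral domain is represented as a subring D of a field type 'a
whose quotient field is the whole of 'a. All modules, ideals, localizations and
overrings are subsets of this ambient field.\<close>

definition is_subring :: "'a::field set \<Rightarrow> bool" where
  "is_subring D \<longleftrightarrow> 0 \<in> D \<and> 1 \<in> D \<and> (\<forall>x\<in>D. \<forall>y\<in>D. x + y \<in> D \<and> x - y \<in> D \<and> x * y \<in> D)"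

definition is_domain_of :: "'a::field set \<Rightarrow> bool" where
  "is_domain_of D \<longleftrightarrow> is_subring D \<and> (\<forall>x. \<exists>a\<in>D. \<exists>b\<in>D. b \<noteq> 0 \<and> x = a / b)"

text \<open>Product of submodules: the set of finite sums of products.
 mod_prod D S is also the D-submodule generated by S.\<close>
definition mod_prod :: "'a::field set \<Rightarrow> 'a set \<Rightarrow> 'a set" where
  "mod_prod A B = {x. \<exists>(n::nat) f g. (\<forall>i<n. f i \<in> A \<and> g i \<in> B) \<and> x = (\<Sum>i<n. f i * g i)}"

definition colon :: "'a::field set \<Rightarrow> 'a set \<Rightarrow> 'a set" where
  "colon A B = {x. \<forall>b\<in>B. x * b \<in> A}"

definition dom_ideal :: "'a::field set \<Rightarrow> 'a set \<Rightarrow> bool" where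
  "dom_ideal D I \<longleftrightarrow> I \<subseteq> D \<and> 0 \<in> I \<and> (\<forall>x\<in>I. \<forall>y\<in>I. x + y \<in> I) \<and> (\<forall>r\<in>D. \<forall>x\<in>I. r * x \<in> I)"

definition dom_prime :: "'a::field set \<Rightarrow> 'a set \<Rightarrow> bool" where
  "dom_prime D P \<longleftrightarrow> dom_ideal D P \<and> P \<noteq> D \<and> (\<forall>a\<in>D. \<forall>b\<in>D. a * b \<in> P \<longrightarrow> a \<in> P \<or> b \<in> P)"

definition dom_maximal :: "'a::field set \<Rightarrow> 'a set \<Rightarrow> bool" where
  "dom_maximal D M \<longleftrightarrow> dom_ideal D M \<and> M \<noteq> D \<and>
     (\<forall>J. dom_ideal D J \<and> M \<subseteq> J \<and> J \<noteq> D \<longrightarrow> J = M)"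

definition radical :: "'a::field set \<Rightarrow> 'a set \<Rightarrow> 'a set" where
  "radical D I = {x \<in> D. \<exists>n::nat. x ^ n \<in> I}"

definition is_radical :: "'a::field set \<Rightarrow> 'a set \<Rightarrow> bool" where
  "is_radical D I \<longleftrightarrow> radical D I = I"

definition loc :: "'a::field set \<Rightarrow> 'a set \<Rightarrow> 'a set" where
  "loc D P = {a / s | a s. a \<in> D \<and> s \<in> D \<and> s \<notin> P}"

definition overring :: "'a::field set \<Rightarrow> 'a set \<Rightarrow> bool" where
  "overring D T \<longleftrightarrow> is_subring T \<and> D \<subseteq> T"

definition valuation_dom :: "'a::field set \<Rightarrow> bool" where
  "valuation_dom V \<longleftrightarrow> (\<forall>x. x \<in> V \<or> inverse x \<in> V)"

definition v_op :: "'a::field set \<Rightarrow> 'a set \<Rightarrow> 'a set" where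
  "v_op R I = colon R (colon R I)"

definition fin_gen_nonzero :: "'a::field set \<Rightarrow> 'a set \<Rightarrow> bool" where
  "fin_gen_nonzero R J \<longleftrightarrow> (\<exists>S. finite S \<and> J = mod_prod R S) \<and> J \<noteq> {0}"

definition t_op :: "'a::field set \<Rightarrow> 'a set \<Rightarrow> 'a set" where
  "t_op R I = \<Union>{v_op R J | J. fin_gen_nonzero R J \<and> J \<subseteq> I}"

definition t_ideal :: "'a::field set \<Rightarrow> 'a set \<Rightarrow> bool" where
  "t_ideal R I \<longleftrightarrow> dom_ideal R I \<and> I \<noteq> {0} \<and> t_op R I = I"

definition t_prime :: "'a::field set \<Rightarrow> 'a set \<Rightarrow> bool" where
  "t_prime R P \<longleftrightarrow> dom_prime R P \<and> t_ideal R P"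

definition t_Max :: "'a::field set \<Rightarrow> 'a set set" where
  "t_Max R = {M. t_ideal R M \<and> M \<noteq> R \<and> (\<forall>J. t_ideal R J \<and> M \<subseteq> J \<and> J \<noteq> R \<longrightarrow> J = M)}"

definition PvMD :: "'a::field set \<Rightarrow> bool" where
  "PvMD R \<longleftrightarrow> (\<forall>M \<in> t_Max R. valuation_dom (loc R M))"

definition sharp_domain :: "'a::field set \<Rightarrow> bool" where
  "sharp_domain D \<longleftrightarrow> (\<forall>M1 M2. M1 \<noteq> {} \<and> M2 \<noteq> {} \<and>
      M1 \<subseteq> {M. dom_maximal D M} \<and> M2 \<subseteq> {M. dom_maximal D M} \<and> M1 \<noteq> M2 \<longrightarrow>
      (\<Inter>M\<in>M1. loc D M) \<noteq> (\<Inter>M\<in>M2. loc D M))"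

definition sharp_sharp_domain :: "'a::field set \<Rightarrow> bool" where
  "sharp_sharp_domain D \<longleftrightarrow> (\<forall>T. overring D T \<longrightarrow> sharp_domain T)"

definition t_sharp :: "'a::field set \<Rightarrow> bool" where
  "t_sharp R \<longleftrightarrow> (\<forall>M1 M2. M1 \<subseteq> t_Max R \<and> M2 \<subseteq> t_Max R \<and> M1 \<noteq> M2 \<longrightarrow>
      (\<Inter>M\<in>M1. loc R M) \<noteq> (\<Inter>M\<in>M2. loc R M))"

definition pairwise_incomparable :: "'a set set \<Rightarrow> bool" where
  "pairwise_incomparable \<P> \<longleftrightarrow> (\<forall>P\<in>\<P>. \<forall>Q\<in>\<P>. P \<subseteq> Q \<longrightarrow> P = Q)"

definition t_sharp_sharp :: "'a::field set \<Rightarrow> bool" where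
  "t_sharp_sharp R \<longleftrightarrow> (\<forall>P1 P2. P1 \<subseteq> {P. t_prime R P} \<and> P2 \<subseteq> {P. t_prime R P} \<and>
      pairwise_incomparable P1 \<and> pairwise_incomparable P2 \<and> P1 \<noteq> P2 \<longrightarrow>
      (\<Inter>P\<in>P1. loc R P) \<noteq> (\<Inter>P\<in>P2. loc R P))"

definition RTP_domain :: "'a::field set \<Rightarrow> bool" where
  "RTP_domain D \<longleftrightarrow> (\<forall>I. dom_ideal D I \<and> I \<noteq> {0} \<longrightarrow>
      mod_prod I (colon D I) = D \<or> is_radical D (mod_prod I (colon D I)))"

definition tRTP_domain :: "'a::field set \<Rightarrow> bool" where
  "tRTP_domain R \<longleftrightarrow> (\<forall>I. dom_ideal R I \<and> I \<noteq> {0} \<longrightarrow>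
      t_op R (mod_prod I (colon R I)) = R \<or> is_radical R (t_op R (mod_prod I (colon R I))))"

definition poly_ring :: "'a::field set \<Rightarrow> 'a poly set" where
  "poly_ring R = {f. \<forall>i. coeff f i \<in> R}"

definition content_ideal :: "'a::field set \<Rightarrow> 'a poly \<Rightarrow> 'a set" where
  "content_ideal R f = mod_prod R (range (coeff f))"

definition N_t :: "'a::field set \<Rightarrow> 'a poly set" where
  "N_t R = {f \<in> poly_ring R. t_op R (content_ideal R f) = R}"

definition t_Nagata :: "'a::field set \<Rightarrow> 'a poly fract set" where
  "t_Nagata R = {Fract f g | f g. f \<in> poly_ring R \<and> g \<in> N_t R}"

end

theory Submission
  imports Defs "HOL-Computational_Algebra.Polynomial_Factorial"
begin

text \<open>
  Let \<open>D\<close> be the t-Nagata ring. In a PvMD every finitely generated ideal is t-invertible, so by Gauss'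
  lemma at the valuation rings \<open>R\<^sub>M\<close> each nonzero \<open>f\<close> over the quotient field \<open>K\<close> has a cofactor \<open>h\<close> with
  \<open>c(f) c(h) \<subseteq> R\<close> and \<open>f h \<in> N\<^sub>t\<close>; hence \<open>f D = c(f) D\<close>. It follows that \<open>N \<mapsto> N \<inter> K\<close> is an order isomorphism
  from the \<open>D\<close>-submodules of \<open>K(X)\<close> onto the t-closed \<open>R\<close>-submodules of \<open>K\<close>, compatible (up to t-closure) with
  products, colons, primes, radicals, maximal ideals and localizations. This gives (1) and (3) directly.

  For (2), \<open>D\<close> is Bezout. Each localization of an overring \<open>T\<close> at a maximal ideal is the localization of \<open>D\<close> at the
  contracted prime, which yields one direction. Conversely, let \<open>T\<close> be the common intersection of the localizations
  at two families of pairwise incomparable primes. As \<open>T\<close> is a \<open>#\<close>-domain, each maximal ideal \<open>N\<close> of \<open>T\<close> has an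
  element \<open>a\<close> lying in no other maximal ideal; \<open>a\<close> lies in a member of either family, necessarily below \<open>N\<close>,
  and a gcd argument shows that these two members coincide.
\<close>

section \<open>Submodules of a field\<close>

text \<open>The correspondence is set up for arbitrary submodules, not only for ideals or fractional
  ideals, because it is applied to localizations and to intersections of them, which are in general
  not fractional. Past the content formula only a few properties of the embedding of constants
  \<open>K\<close> into \<open>K(X)\<close> matter; the locale \<open>content_extension\<close>
  isolates them, and polynomials and the PvMD hypothesis occur only where they are verified.
  Degenerate cases shape many statements. \<open>t_op R {0}\<close> is empty, so the zero module is
  excluded wherever a t-closure is formed. A maximal ideal of an overring may contract to zero,
  which is not a t-prime. The obstacle in (2) is that incomparable primes representing
  \<open>T\<close> need not be maximal in \<open>T\<close>, so the \<open>#\<close> property says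
  nothing about them directly. It only supplies elements isolating single maximal ideals, and these
  detect which primes must occur below each of them.\<close>

definition submod :: "'a::field set \<Rightarrow> 'a set \<Rightarrow> bool" where
  "submod D A \<longleftrightarrow> 0 \<in> A \<and> (\<forall>x\<in>A. \<forall>y\<in>A. x + y \<in> A) \<and> (\<forall>r\<in>D. \<forall>x\<in>A. r * x \<in> A)"

lemma submodD:
  assumes "submod D A"
  shows "0 \<in> A" "\<And>x y. x \<in> A \<Longrightarrow> y \<in> A \<Longrightarrow> x + y \<in> A" "\<And>r x. r \<in> D \<Longrightarrow> x \<in> A \<Longrightarrow> r * x \<in> A"
  using assms unfolding submod_def by auto

lemma submod_sum:
  assumes "submod D A" "\<And>i. i \<in> I \<Longrightarrow> f i \<in> A"
  shows "sum f I \<in> A"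
  using assms(2) by (induction I rule: infinite_finite_induct) (auto intro: submodD[OF assms(1)])

lemma dom_ideal_iff_submod: "dom_ideal D I \<longleftrightarrow> submod D I \<and> I \<subseteq> D"
  unfolding dom_ideal_def submod_def by auto

lemma is_subringD:
  assumes "is_subring D"
  shows "0 \<in> D" "1 \<in> D" "\<And>x y. x \<in> D \<Longrightarrow> y \<in> D \<Longrightarrow> x + y \<in> D"
    "\<And>x y. x \<in> D \<Longrightarrow> y \<in> D \<Longrightarrow> x - y \<in> D" "\<And>x y. x \<in> D \<Longrightarrow> y \<in> D \<Longrightarrow> x * y \<in> D"
    "\<And>x. x \<in> D \<Longrightarrow> - x \<in> D" "\<And>x n. x \<in> D \<Longrightarrow> x ^ n \<in> D"
proof -
  show "x ^ n \<in> D" if "x \<in> D" for x and n :: nat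
    using assms that by (induction n) (auto simp: is_subring_def)
  show "- x \<in> D" if "x \<in> D" for x
    using assms that unfolding is_subring_def by (metis diff_0)
qed (use assms in \<open>auto simp: is_subring_def\<close>)

lemma submod_subring: "is_subring D \<Longrightarrow> submod D D"
  unfolding submod_def by (auto dest: is_subringD)

lemma submod_Inter: "(\<And>A. A \<in> \<A> \<Longrightarrow> submod D A) \<Longrightarrow> submod D (\<Inter>\<A>)"
  unfolding submod_def by auto

lemma submod_Union_chain:
  assumes "subset.chain \<A> \<C>" "\<C> \<noteq> {}" "\<And>A. A \<in> \<C> \<Longrightarrow> submod D A"
  shows "submod D (\<Union>\<C>)"
proof -
  have "x + y \<in> \<Union>\<C>" if "x \<in> A" "A \<in> \<C>" "y \<in> B" "B \<in> \<C>" for x y A B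
  proof -
    have "A \<subseteq> B \<or> B \<subseteq> A"
      using assms(1) that by (auto simp: subset.chain_def)
    then show ?thesis
      using that assms(3) by (meson UnionI in_mono submodD(2))
  qed
  moreover have "0 \<in> \<Union>\<C>"
    using assms(2,3) submodD(1) by (meson UnionI ex_in_conv)
  moreover have "r * x \<in> \<Union>\<C>" if "r \<in> D" "x \<in> A" "A \<in> \<C>" for r x A
    using submodD(3)[OF assms(3)[OF that(3)] that(1,2)] that(3) by (rule UnionI[rotated])
  ultimately show ?thesis
    unfolding submod_def by (intro conjI ballI) (auto elim!: UnionE)
qed

lemma mod_prodI: "a \<in> A \<Longrightarrow> b \<in> B \<Longrightarrow> a * b \<in> mod_prod A B"
  unfolding mod_prod_def
  by (rule CollectI, rule exI[of _ 1], rule exI[of _ "\<lambda>_. a"], rule exI[of _ "\<lambda>_. b"]) auto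

lemma mod_prod_zero: "0 \<in> mod_prod A B"
  unfolding mod_prod_def by (auto intro!: exI[of _ "0::nat"])

lemma mod_prod_add:
  assumes "x \<in> mod_prod A B" "y \<in> mod_prod A B"
  shows "x + y \<in> mod_prod A B"
proof -
  obtain n f g where x: "\<forall>i<n. f i \<in> A \<and> g i \<in> B" "x = (\<Sum>i<(n::nat). f i * g i)"
    using assms(1) unfolding mod_prod_def by blast
  obtain m f' g' where y: "\<forall>i<m. f' i \<in> A \<and> g' i \<in> B" "y = (\<Sum>i<(m::nat). f' i * g' i)"
    using assms(2) unfolding mod_prod_def by blast
  define F where "F = (\<lambda>i. if i < n then f i else f' (i - n))"
  define G where "G = (\<lambda>i. if i < n then g i else g' (i - n))"
  have "(\<Sum>i<n+m. F i * G i) = (\<Sum>i<n. F i * G i) + (\<Sum>i<m. F (n + i) * G (n + i))"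
    by (induction m) auto
  also have "\<dots> = x + y"
    unfolding x(2) y(2) by (simp add: F_def G_def)
  finally have "x + y = (\<Sum>i<n+m. F i * G i)" ..
  moreover have "\<forall>i<n+m. F i \<in> A \<and> G i \<in> B"
    using x(1) y(1) by (auto simp: F_def G_def)
  ultimately show ?thesis
    unfolding mod_prod_def by blast
qed

lemma mod_prod_least:
  assumes "submod D C" "\<And>a b. a \<in> A \<Longrightarrow> b \<in> B \<Longrightarrow> a * b \<in> C"
  shows "mod_prod A B \<subseteq> C"
  unfolding mod_prod_def by (auto intro!: submod_sum[OF assms(1)] assms(2))

lemma mod_prod_mono: "A \<subseteq> A' \<Longrightarrow> B \<subseteq> B' \<Longrightarrow> mod_prod A B \<subseteq> mod_prod A' B'"
  unfolding mod_prod_def by (intro Collect_mono impI, elim exE conjE, intro exI conjI) auto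

lemma submod_mod_prod:
  assumes "submod D A"
  shows "submod D (mod_prod A B)"
proof -
  have "r * x \<in> mod_prod A B" if r: "r \<in> D" and "x \<in> mod_prod A B" for r x
  proof -
    obtain n f g where x: "\<forall>i<n. f i \<in> A \<and> g i \<in> B" "x = (\<Sum>i<(n::nat). f i * g i)"
      using \<open>x \<in> mod_prod A B\<close> unfolding mod_prod_def by blast
    have "r * x = (\<Sum>i<n. (r * f i) * g i)"
      unfolding x(2) by (simp add: sum_distrib_left mult.assoc)
    moreover have "\<forall>i<n. r * f i \<in> A \<and> g i \<in> B"
      using x(1) submodD(3)[OF assms r] by blast
    ultimately show ?thesis
      unfolding mod_prod_def by (intro CollectI exI[of _ n] exI[of _ "\<lambda>i. r * f i"] exI[of _ g]) auto
  qed
  then show ?thesis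
    unfolding submod_def using mod_prod_zero mod_prod_add by blast
qed

lemma submod_generated: "is_subring D \<Longrightarrow> submod D (mod_prod D S)"
  by (intro submod_mod_prod submod_subring)

lemma generated_superset: "is_subring D \<Longrightarrow> S \<subseteq> mod_prod D S"
  by (metis is_subringD(2) mod_prodI mult_1 subsetI)

lemma generated_subset_iff:
  assumes "is_subring D" "submod D A"
  shows "mod_prod D S \<subseteq> A \<longleftrightarrow> S \<subseteq> A"
proof
  show "S \<subseteq> A" if "mod_prod D S \<subseteq> A"
    using that generated_superset[OF assms(1)] by blast
  show "mod_prod D S \<subseteq> A" if "S \<subseteq> A"
    by (rule mod_prod_least[OF assms(2)]) (use that submodD(3)[OF assms(2)] in blast)
qed

lemma generated_insert_zero: "is_subring D \<Longrightarrow> mod_prod D (insert 0 S) = mod_prod D S"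
  using generated_subset_iff[OF _ submod_generated] generated_superset[of D] mod_prod_zero
  by (metis insert_subset subset_antisym)

lemma generated_singleton:
  assumes "is_subring D"
  shows "mod_prod D {z} = {d * z | d. d \<in> D}"
proof
  have "submod D {d * z | d. d \<in> D}"
    unfolding submod_def
  proof (intro conjI ballI)
    show "0 \<in> {d * z | d. d \<in> D}"
      using is_subringD(1)[OF assms] by force
    show "x + y \<in> {d * z | d. d \<in> D}" if "x \<in> {d * z | d. d \<in> D}" "y \<in> {d * z | d. d \<in> D}" for x y
      using that is_subringD(3)[OF assms] by (auto simp: ring_distribs(2)[symmetric])
    show "r * x \<in> {d * z | d. d \<in> D}" if "r \<in> D" "x \<in> {d * z | d. d \<in> D}" for r x
      using that is_subringD(5)[OF assms] by (auto simp: mult.assoc[symmetric])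
  qed
  then show "mod_prod D {z} \<subseteq> {d * z | d. d \<in> D}"
    by (rule mod_prod_least) auto
qed (auto intro: mod_prodI)

text \<open>An element is a single finite sum, so it involves finitely many generators. This is the
  source of the finite character of extensions, matching that of the t-operation.\<close>

lemma generated_finite:
  assumes "is_subring D" "x \<in> mod_prod D A"
  obtains S where "finite S" "S \<subseteq> A" "x \<in> mod_prod D S"
proof -
  obtain n f g where x: "\<forall>i<n. f i \<in> D \<and> g i \<in> A" "x = (\<Sum>i<(n::nat). f i * g i)"
    using assms(2) unfolding mod_prod_def by blast
  have "x \<in> mod_prod D (g ` {..<n})"
    unfolding mod_prod_def using x by blast
  then show ?thesis
    using x(1) by (intro that[of "g ` {..<n}"]) auto
qed

lemma submod_colon: "is_subring D \<Longrightarrow> submod D (colon D A)"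
  unfolding submod_def colon_def
  by (auto simp: ring_distribs is_subringD mult.assoc)

lemma colon_generated:
  assumes "is_subring D"
  shows "colon D (mod_prod D S) = colon D S"
proof
  show "colon D (mod_prod D S) \<subseteq> colon D S"
    using generated_superset[OF assms] unfolding colon_def by blast
  show "colon D S \<subseteq> colon D (mod_prod D S)"
  proof
    fix x assume x: "x \<in> colon D S"
    \<comment> \<open>For fixed \<open>x\<close> the admissible factors form a submodule, so testing
      generators is enough. The same device is used for products and colons of extensions.\<close>
    have "submod D {y. x * y \<in> D}"
      unfolding submod_def using assms
      by (auto simp: ring_distribs is_subringD mult.left_commute)
    then have "mod_prod D S \<subseteq> {y. x * y \<in> D}"
      using generated_subset_iff[OF assms] x unfolding colon_def by blast
    then show "x \<in> colon D (mod_prod D S)"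
      unfolding colon_def by blast
  qed
qed

section \<open>Primes, maximal ideals and localizations\<close>

lemma dom_primeD:
  assumes "dom_prime D P"
  shows "submod D P" "P \<subseteq> D" "\<And>a b. a \<in> D \<Longrightarrow> b \<in> D \<Longrightarrow> a * b \<in> P \<Longrightarrow> a \<in> P \<or> b \<in> P" "1 \<notin> P"
proof -
  show s: "submod D P" "P \<subseteq> D"
    using assms unfolding dom_prime_def dom_ideal_iff_submod by auto
  show "1 \<notin> P"
    using assms s submodD(3)[OF s(1), of _ 1] unfolding dom_prime_def by auto
qed (use assms in \<open>auto simp: dom_prime_def\<close>)

lemma proper_ideal_iff: "dom_ideal D I \<Longrightarrow> 1 \<in> D \<Longrightarrow> I \<noteq> D \<longleftrightarrow> 1 \<notin> I"
  unfolding dom_ideal_def by (metis mult.right_neutral subsetI subset_antisym)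

lemma dom_prime_restrict:
  assumes "dom_prime T P" "is_subring D" "D \<subseteq> T"
  shows "dom_prime D (P \<inter> D)"
proof -
  have "dom_ideal D (P \<inter> D)"
    unfolding dom_ideal_def
    using submodD[OF dom_primeD(1)[OF assms(1)]] is_subringD[OF assms(2)] assms(3)
    by (intro conjI ballI IntI) (auto simp: subset_iff)
  then show ?thesis
    using dom_primeD(3,4)[OF assms(1)] is_subringD(2)[OF assms(2)] assms(3)
    unfolding dom_prime_def by (intro conjI ballI impI) (auto simp: subset_iff)
qed

text \<open>The ideal \<open>M + D a\<close>, in explicit form; it serves the primality proofs both
  for maximal ideals and for maximal t-ideals.\<close>

lemma ideal_adjoin:
  assumes "is_subring D" "dom_ideal D M" "a \<in> D"
  shows "dom_ideal D {m + d * a | m d. m \<in> M \<and> d \<in> D}"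
proof -
  have M: "submod D M" "M \<subseteq> D"
    using assms(2) by (auto simp: dom_ideal_iff_submod)
  let ?J = "{m + d * a | m d. m \<in> M \<and> d \<in> D}"
  have "0 \<in> ?J"
    using submodD(1)[OF M(1)] is_subringD(1)[OF assms(1)] by force
  moreover have "x + y \<in> ?J" if "x \<in> ?J" "y \<in> ?J" for x y
  proof -
    obtain m d m' d' where "x = m + d * a" "y = m' + d' * a" "m \<in> M" "m' \<in> M" "d \<in> D" "d' \<in> D"
      using \<open>x \<in> ?J\<close> \<open>y \<in> ?J\<close> by auto
    then have "x + y = (m + m') + (d + d') * a" "m + m' \<in> M" "d + d' \<in> D"
      by (auto simp: algebra_simps intro: submodD(2)[OF M(1)] is_subringD(3)[OF assms(1)])
    then show ?thesis by blast
  qed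
  moreover have "r * x \<in> ?J" if "r \<in> D" "x \<in> ?J" for r x
  proof -
    obtain m d where "x = m + d * a" "m \<in> M" "d \<in> D"
      using \<open>x \<in> ?J\<close> by auto
    then have "r * x = r * m + (r * d) * a" "r * m \<in> M" "r * d \<in> D"
      using \<open>r \<in> D\<close> submodD(3)[OF M(1)] is_subringD(5)[OF assms(1)] by (auto simp: ring_distribs mult.assoc)
    then show ?thesis by blast
  qed
  moreover have "?J \<subseteq> D"
    using M assms(1,3) by (auto intro!: is_subringD(3,5)[OF assms(1)])
  ultimately show ?thesis
    unfolding dom_ideal_def by blast
qed

lemma dom_maximal_prime:
  assumes D: "is_subring D" and M: "dom_maximal D M"
  shows "dom_prime D M"
proof -
  have id: "dom_ideal D M" and "M \<noteq> D"
    using M unfolding dom_maximal_def by auto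
  have sM: "submod D M" "M \<subseteq> D"
    using id by (auto simp: dom_ideal_iff_submod)
  have "a \<in> M" if ab: "a \<in> D" "b \<in> D" "a * b \<in> M" "b \<notin> M" for a b
  proof -
    let ?J = "{m + d * b | m d. m \<in> M \<and> d \<in> D}"
    have J: "dom_ideal D ?J"
      by (rule ideal_adjoin[OF D id ab(2)])
    have "M \<subseteq> ?J"
      using is_subringD(1)[OF D] by force
    moreover have "b \<in> ?J"
      using is_subringD(2)[OF D] submodD(1)[OF sM(1)] by force
    ultimately have "?J = D"
      using M J ab(4) unfolding dom_maximal_def by blast
    then obtain m d where md: "m \<in> M" "d \<in> D" "1 = m + d * b"
      using is_subringD(2)[OF D] by blast
    \<comment> \<open>The equation \<open>1 = m + d * b\<close>, multiplied by
      \<open>a\<close>.\<close>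
    have "a = a * m + d * (a * b)"
      using md(3) by (metis mult.commute mult.left_commute mult.right_neutral ring_class.ring_distribs(1))
    then show ?thesis
      using submodD(2,3)[OF sM(1)] md ab by metis
  qed
  then show ?thesis
    unfolding dom_prime_def using id \<open>M \<noteq> D\<close> by blast
qed

text \<open>Zorn's lemma, with properness expressed as \<open>1 \<notin> J\<close> because this form
  passes to unions of chains.\<close>

lemma proper_ideal_in_maximal:
  assumes D: "is_subring D" and I: "dom_ideal D I" "1 \<notin> I"
  obtains M where "dom_maximal D M" "I \<subseteq> M"
proof -
  let ?A = "{J. dom_ideal D J \<and> 1 \<notin> J \<and> I \<subseteq> J}"
  have "\<exists>M\<in>?A. \<forall>X\<in>?A. M \<subseteq> X \<longrightarrow> X = M"
  proof (rule subset_Zorn_nonempty)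
    show "?A \<noteq> {}" using I by blast
    fix \<C> assume C: "\<C> \<noteq> {}" "subset.chain ?A \<C>"
    then have "\<C> \<subseteq> ?A" by (simp add: subset.chain_def)
    moreover from this have "submod D (\<Union>\<C>)"
      using submod_Union_chain[OF C(2,1)] by (auto simp: dom_ideal_iff_submod)
    ultimately show "\<Union>\<C> \<in> ?A"
      using C(1) by (auto simp: dom_ideal_iff_submod)
  qed
  then obtain M where M: "M \<in> ?A" "\<forall>X\<in>?A. M \<subseteq> X \<longrightarrow> X = M" by (rule bexE)
  have "dom_maximal D M"
    unfolding dom_maximal_def
  proof (intro conjI allI impI)
    show "dom_ideal D M" "M \<noteq> D" using M(1) is_subringD(2)[OF D] by auto
    fix J assume J: "dom_ideal D J \<and> M \<subseteq> J \<and> J \<noteq> D"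
    then have "J \<in> ?A"
      using M(1) proper_ideal_iff[of D J] is_subringD(2)[OF D] by auto
    then show "J = M" using M(2) J by simp
  qed
  then show ?thesis using M(1) by (intro that) auto
qed

lemma loc_iff: "x \<in> loc D P \<longleftrightarrow> (\<exists>a s. a \<in> D \<and> s \<in> D \<and> s \<notin> P \<and> x = a / s)"
  by (auto simp: loc_def)

lemma loc_superset: "dom_prime D P \<Longrightarrow> is_subring D \<Longrightarrow> D \<subseteq> loc D P"
  by (intro subsetI loc_iff[THEN iffD2] exI[of _ "1"] exI) (auto dest: dom_primeD(4) is_subringD(2))

lemma submod_loc:
  assumes "is_subring D" "dom_prime D P"
  shows "submod D (loc D P)"
proof -
  note D = is_subringD[OF assms(1)] and P = dom_primeD[OF assms(2)]
  have 0: "0 \<in> P" using P(1) by (rule submodD(1))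
  have "0 \<in> loc D P" using loc_superset assms D(1) by blast
  moreover have "x + y \<in> loc D P" if xy: "x \<in> loc D P" "y \<in> loc D P" for x y
  proof -
    obtain a s where x: "a \<in> D" "s \<in> D" "s \<notin> P" "x = a / s" using xy(1) by (auto simp: loc_iff)
    obtain b t where y: "b \<in> D" "t \<in> D" "t \<notin> P" "y = b / t" using xy(2) by (auto simp: loc_iff)
    have "s \<noteq> 0" "t \<noteq> 0" using 0 x y by auto
    then have "x + y = (a * t + b * s) / (s * t)"
      using x y by (simp add: add_frac_eq)
    moreover have "a * t + b * s \<in> D" "s * t \<in> D" "s * t \<notin> P"
      using x y D(3,5) P(3) by blast+
    ultimately show ?thesis by (auto simp: loc_iff)
  qed
  moreover have "r * x \<in> loc D P" if "r \<in> D" "x \<in> loc D P" for r x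
    using that D by (auto simp: loc_iff) (metis times_divide_eq_right)
  ultimately show ?thesis unfolding submod_def by blast
qed

lemma is_subring_loc:
  assumes "is_subring D" "dom_prime D P"
  shows "is_subring (loc D P)"
proof -
  note D = is_subringD[OF assms(1)] and P = dom_primeD[OF assms(2)] and L = submodD[OF submod_loc[OF assms]]
  have neg: "- x \<in> loc D P" if "x \<in> loc D P" for x
    using L(3)[of "-1" x] that D by auto
  have "x * y \<in> loc D P" if xy: "x \<in> loc D P" "y \<in> loc D P" for x y
  proof -
    obtain a s where x: "a \<in> D" "s \<in> D" "s \<notin> P" "x = a / s" using xy(1) by (auto simp: loc_iff)
    obtain b t where y: "b \<in> D" "t \<in> D" "t \<notin> P" "y = b / t" using xy(2) by (auto simp: loc_iff)
    have "x * y = (a * b) / (s * t)" using x y by simp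
    moreover have "a * b \<in> D" "s * t \<in> D" "s * t \<notin> P"
      using x y D(3,5) P(3) by blast+
    ultimately show ?thesis by (auto simp: loc_iff)
  qed
  moreover have "x - y \<in> loc D P" if "x \<in> loc D P" "y \<in> loc D P" for x y
    using L(2)[of x "-y"] that neg by auto
  moreover have "1 \<in> loc D P" using loc_superset assms D(2) by blast
  ultimately show ?thesis
    unfolding is_subring_def using L(1,2) by (intro conjI ballI) auto
qed

lemma loc_antimono: "P \<subseteq> Q \<Longrightarrow> loc D Q \<subseteq> loc D P"
  unfolding loc_def by blast

text \<open>Shows that a prime can be read off from its localization; hence inclusions of
  localizations reflect inclusions of primes.\<close>

lemma mem_prime_iff_loc:
  assumes "is_subring D" "dom_prime D P" "x \<in> D"
  shows "x \<in> P \<longleftrightarrow> x = 0 \<or> inverse x \<notin> loc D P"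
proof
  note P = dom_primeD[OF assms(2)]
  have 0: "0 \<in> P" using P(1) by (rule submodD(1))
  show "x = 0 \<or> inverse x \<notin> loc D P" if x: "x \<in> P"
  proof (rule ccontr)
    assume "\<not> ?thesis"
    then obtain a s where as: "a \<in> D" "s \<in> D" "s \<notin> P" "inverse x = a / s" and "x \<noteq> 0"
      by (auto simp: loc_iff)
    have "s \<noteq> 0" using 0 as by auto
    then have "s = a * x" using as(4) \<open>x \<noteq> 0\<close> by (simp add: field_simps)
    then show False using as submodD(3)[OF P(1)] x by blast
  qed
  show "x \<in> P" if "x = 0 \<or> inverse x \<notin> loc D P"
  proof (rule ccontr)
    assume "x \<notin> P"
    then have "inverse x \<in> loc D P"
      using assms(3) is_subringD(2)[OF assms(1)] unfolding loc_iff by (metis inverse_eq_divide)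
    then show False using that \<open>x \<notin> P\<close> 0 by blast
  qed
qed

lemma loc_subset_imp:
  assumes "is_subring D" "dom_prime D P" "dom_prime D Q" "loc D Q \<subseteq> loc D P"
  shows "P \<subseteq> Q"
  using mem_prime_iff_loc[OF assms(1)] assms dom_primeD(2)[OF assms(2)] by blast

lemma loc_not_UNIV:
  assumes "is_subring D" "dom_prime D P" "P \<noteq> {0}"
  shows "loc D P \<noteq> UNIV"
proof -
  obtain p where "p \<in> P" "p \<noteq> 0"
    using assms(3) submodD(1)[OF dom_primeD(1)[OF assms(2)]] by blast
  then show ?thesis
    using mem_prime_iff_loc[OF assms(1,2), of p] dom_primeD(2)[OF assms(2)] by blast
qed

text \<open>The extension of \<open>P\<close> to \<open>loc D P\<close>, that is, the maximal ideal
  of this local ring, written with explicit fractions instead of as a generated ideal.\<close>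

definition max_of_loc :: "'a::field set \<Rightarrow> 'a set \<Rightarrow> 'a set" where
  "max_of_loc D P = {c / e | c e. c \<in> P \<and> e \<in> D \<and> e \<notin> P}"

lemma dom_prime_max_of_loc:
  assumes "is_subring D" "dom_prime D P"
  shows "dom_prime (loc D P) (max_of_loc D P)"
proof -
  note D = is_subringD[OF assms(1)] and P = dom_primeD[OF assms(2)]
  note sP = submodD[OF P(1)]
  let ?m = "max_of_loc D P"
  have nz: "s \<noteq> 0" if "s \<notin> P" for s using that sP(1) by auto
  have mI: "c / e \<in> ?m" if "c \<in> P" "e \<in> D" "e \<notin> P" for c e
    using that unfolding max_of_loc_def by blast
  have mE: "\<exists>c e. x = c / e \<and> c \<in> P \<and> e \<in> D \<and> e \<notin> P" if "x \<in> ?m" for x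
    using that unfolding max_of_loc_def by blast
  \<comment> \<open>Membership does not depend on the chosen fraction: any representation with
    denominator outside \<open>P\<close> has its numerator in \<open>P\<close>.\<close>
  have num: "a \<in> P" if as: "a / s \<in> ?m" "a \<in> D" "s \<in> D" "s \<notin> P" for a s
  proof -
    obtain c e where ce: "a / s = c / e" "c \<in> P" "e \<in> D" "e \<notin> P" using mE[OF as(1)] by blast
    then have "a * e = s * c" using nz as(4) by (simp add: frac_eq_eq mult.commute)
    then have "a * e \<in> P" using sP(3) as ce by simp
    then show ?thesis using P(3) as ce by blast
  qed
  have "dom_ideal (loc D P) ?m"
    unfolding dom_ideal_def
  proof (intro conjI ballI)
    show "?m \<subseteq> loc D P" unfolding max_of_loc_def loc_def using P(2) by blast
    show "0 \<in> ?m" using mI[of 0 1] sP(1) D(2) P(4) by simp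
    show "x + y \<in> ?m" if "x \<in> ?m" "y \<in> ?m" for x y
    proof -
      obtain c e where x: "x = c / e" "c \<in> P" "e \<in> D" "e \<notin> P" using mE \<open>x \<in> ?m\<close> by blast
      obtain d f where y: "y = d / f" "d \<in> P" "f \<in> D" "f \<notin> P" using mE \<open>y \<in> ?m\<close> by blast
      have "x + y = (f * c + e * d) / (e * f)"
        using x y nz by (simp add: add_frac_eq mult.commute)
      moreover have "f * c + e * d \<in> P" "e * f \<in> D" "e * f \<notin> P"
        using x y sP D(5) P(3) by blast+
      ultimately show ?thesis using mI by simp
    qed
    show "r * x \<in> ?m" if "r \<in> loc D P" "x \<in> ?m" for r x
    proof -
      obtain c e where x: "x = c / e" "c \<in> P" "e \<in> D" "e \<notin> P" using mE \<open>x \<in> ?m\<close> by blast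
      obtain a s where r: "a \<in> D" "s \<in> D" "s \<notin> P" "r = a / s" using \<open>r \<in> loc D P\<close> by (auto simp: loc_iff)
      have "r * x = (a * c) / (s * e)" using x r by simp
      moreover have "a * c \<in> P" "s * e \<in> D" "s * e \<notin> P"
        using x r sP D(5) P(3) by blast+
      ultimately show ?thesis using mI by simp
    qed
  qed
  moreover have "1 \<in> loc D P" using loc_superset assms D(2) by blast
  moreover have "1 \<notin> ?m" using num[of 1 1] D(2) P(4) by auto
  moreover have "x \<in> ?m \<or> y \<in> ?m" if xy: "x \<in> loc D P" "y \<in> loc D P" "x * y \<in> ?m" for x y
  proof -
    obtain a s where x: "a \<in> D" "s \<in> D" "s \<notin> P" "x = a / s" using xy(1) by (auto simp: loc_iff)
    obtain b t where y: "b \<in> D" "t \<in> D" "t \<notin> P" "y = b / t" using xy(2) by (auto simp: loc_iff)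
    have "(a * b) / (s * t) \<in> ?m" "s * t \<in> D" "s * t \<notin> P" "a * b \<in> D"
      using x y xy(3) D(5) P(3) by auto
    then have "a \<in> P \<or> b \<in> P" using num P(3) x y by blast
    then show ?thesis using mI x y by blast
  qed
  ultimately show ?thesis unfolding dom_prime_def by blast
qed

lemma max_of_loc_restrict:
  assumes "is_subring D" "dom_prime D P"
  shows "max_of_loc D P \<inter> D = P"
proof
  note D = is_subringD[OF assms(1)] and P = dom_primeD[OF assms(2)]
  show "P \<subseteq> max_of_loc D P \<inter> D"
    unfolding max_of_loc_def using D(2) P(2,4) by (force intro: exI[of _ 1])
  show "max_of_loc D P \<inter> D \<subseteq> P"
  proof
    fix x assume "x \<in> max_of_loc D P \<inter> D"
    then obtain c e where ce: "x \<in> D" "x = c / e" "c \<in> P" "e \<in> D" "e \<notin> P"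
      unfolding max_of_loc_def by blast
    have "e \<noteq> 0" using ce(5) submodD(1)[OF P(1)] by auto
    then have "x * e \<in> P" using ce by simp
    then show "x \<in> P" using P(3) ce by blast
  qed
qed

section \<open>Bezout subrings of a field\<close>

text \<open>The pair ranges over the whole field, so fractional ideals are included. Taking one
  element to be \<open>1\<close> shows that the field is the quotient field of \<open>D\<close>, and
  the condition passes to overrings with the same witnesses.\<close>

definition bezout :: "'a::field set \<Rightarrow> bool" where
  "bezout D \<longleftrightarrow> is_subring D \<and>
     (\<forall>x y. \<exists>z a b c d. a \<in> D \<and> b \<in> D \<and> c \<in> D \<and> d \<in> D \<and> x = a * z \<and> y = b * z \<and> z = c * x + d * y)"

lemma bezout_subring: "bezout D \<Longrightarrow> is_subring D"
  unfolding bezout_def by blast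

lemma bezoutE:
  assumes "bezout D"
  obtains z a b c d where "a \<in> D" "b \<in> D" "c \<in> D" "d \<in> D" "x = a * z" "y = b * z" "z = c * x + d * y"
  using assms[unfolded bezout_def, THEN conjunct2, THEN spec[of _ x], THEN spec[of _ y]]
  by (elim exE conjE) (rule that)

lemma bezout_overring:
  assumes "bezout D" "overring D T"
  shows "bezout T"
proof -
  have T: "is_subring T" "D \<subseteq> T"
    using assms(2) unfolding overring_def by auto
  have "\<exists>z a b c d. a \<in> T \<and> b \<in> T \<and> c \<in> T \<and> d \<in> T \<and> x = a * z \<and> y = b * z \<and> z = c * x + d * y" for x y
  proof -
    obtain z a b c d where h: "a \<in> D" "b \<in> D" "c \<in> D" "d \<in> D" "x = a * z" "y = b * z" "z = c * x + d * y"
      by (rule bezoutE[OF assms(1)])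
    show ?thesis
      by (intro exI[of _ z] exI[of _ a] exI[of _ b] exI[of _ c] exI[of _ d] conjI subsetD[OF T(2)]) (rule h)+
  qed
  then show ?thesis
    using T(1) unfolding bezout_def by simp
qed

text \<open>Let \<open>z\<close> generate the fractional ideal of \<open>1\<close> and
  \<open>x\<close>. From \<open>1 = a * z\<close> and \<open>x = b * z\<close> one gets
  \<open>x = b / a\<close>, and multiplying \<open>z = c + d * x\<close> by \<open>a\<close> gives
  the coprimality relation.\<close>

lemma bezout_coprime_fraction:
  assumes "bezout D"
  obtains a b c d where "a \<in> D" "b \<in> D" "c \<in> D" "d \<in> D" "a \<noteq> 0" "x = b / a" "c * a + d * b = 1"
proof -
  obtain z a b c d where h: "a \<in> D" "b \<in> D" "c \<in> D" "d \<in> D" "1 = a * z" "x = b * z" "z = c * 1 + d * x"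
    by (rule bezoutE[OF assms])
  have "a \<noteq> 0" using h(5) by auto
  then have z: "z = 1 / a" using h(5) by (simp add: field_simps)
  have "1 = a * (c * 1 + d * (b * z))"
    using h(5-7) by metis
  also have "\<dots> = c * a + d * b * (a * z)"
    by (simp add: algebra_simps)
  finally have "c * a + d * b = 1"
    using h(5) by simp
  then show ?thesis
    using that[OF h(1-4) \<open>a \<noteq> 0\<close>] h(6) z by simp
qed

lemma coprime_not_both_in_prime:
  assumes "dom_prime D P" "c \<in> D" "d \<in> D" "c * a + d * b = 1"
  shows "\<not> (a \<in> P \<and> b \<in> P)"
proof
  assume "a \<in> P \<and> b \<in> P"
  then have "c * a + d * b \<in> P"
    using submodD(2,3)[OF dom_primeD(1)[OF assms(1)]] assms(2,3) by simp
  then show False using dom_primeD(4)[OF assms(1)] assms(4) by simp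
qed

text \<open>Write an element \<open>u / s\<close> of \<open>loc T M\<close> in lowest terms over
  \<open>D\<close> as \<open>b / a\<close>. Then \<open>b * s = u * a\<close>, so
  \<open>a \<in> M\<close> would force \<open>b \<in> M\<close>, against coprimality; hence
  \<open>a\<close> is an admissible denominator over \<open>D\<close>.\<close>

lemma bezout_loc_overring:
  assumes D: "bezout D" and T: "overring D T" and M: "dom_prime T M"
  shows "loc T M = loc D (M \<inter> D)"
proof
  have sT: "is_subring T" "D \<subseteq> T"
    using T unfolding overring_def by auto
  have P: "dom_prime D (M \<inter> D)"
    by (rule dom_prime_restrict[OF M bezout_subring[OF D] sT(2)])
  show "loc D (M \<inter> D) \<subseteq> loc T M"
    using sT(2) unfolding loc_def by blast
  show "loc T M \<subseteq> loc D (M \<inter> D)"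
  proof
    fix x assume "x \<in> loc T M"
    then obtain u s where us: "u \<in> T" "s \<in> T" "s \<notin> M" "x = u / s" by (auto simp: loc_iff)
    have s0: "s \<noteq> 0" using us(3) submodD(1)[OF dom_primeD(1)[OF M]] by auto
    obtain a b c d where h: "a \<in> D" "b \<in> D" "c \<in> D" "d \<in> D" "a \<noteq> 0" "x = b / a" "c * a + d * b = 1"
      using bezout_coprime_fraction[OF D] .
    have "a \<notin> M"
    proof
      assume a: "a \<in> M"
      have "b * s = u * a"
        using h(6) us(4) s0 h(5) by (simp add: field_simps)
      then have "b * s \<in> M"
        using submodD(3)[OF dom_primeD(1)[OF M] us(1) a] by simp
      then have "b \<in> M"
        using dom_primeD(3)[OF M, of b s] us(2,3) h(2) sT(2) by blast
      then show False
        using coprime_not_both_in_prime[OF P h(3,4,7)] a h(1,2) by blast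
    qed
    then show "x \<in> loc D (M \<inter> D)"
      using h(1,2,6) unfolding loc_iff by blast
  qed
qed

text \<open>For \<open>p\<close> only in \<open>P\<close> and \<open>q\<close> only in
  \<open>Q\<close>, write \<open>p / q\<close> in lowest terms as \<open>b / a\<close>. The relation
  \<open>p * a = q * b\<close> puts \<open>a\<close> in \<open>Q\<close> and \<open>b\<close> in
  \<open>P\<close>, hence both in \<open>N\<close>, although they are coprime.\<close>

lemma bezout_primes_comparable:
  assumes D: "bezout D" and N: "dom_prime D N" and P: "dom_prime D P" "P \<subseteq> N" and Q: "dom_prime D Q" "Q \<subseteq> N"
  shows "P \<subseteq> Q \<or> Q \<subseteq> P"
proof (rule ccontr)
  assume "\<not> ?thesis"
  then obtain p q where pq: "p \<in> P" "p \<notin> Q" "q \<in> Q" "q \<notin> P" by blast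
  note pd = dom_primeD(2)[OF P(1)] dom_primeD(2)[OF Q(1)]
  obtain a b c d where h: "a \<in> D" "b \<in> D" "c \<in> D" "d \<in> D" "a \<noteq> 0" "p / q = b / a" "c * a + d * b = 1"
    using bezout_coprime_fraction[OF D] .
  have "q \<noteq> 0" using pq submodD(1)[OF dom_primeD(1)[OF P(1)]] by auto
  then have e: "p * a = b * q" "q * b = a * p"
    using h(5,6) by (simp_all add: field_simps)
  have "p * a \<in> Q"
    unfolding e(1) by (rule submodD(3)[OF dom_primeD(1)[OF Q(1)] h(2) pq(3)])
  then have "a \<in> N"
    using dom_primeD(3)[OF Q(1), of p a] pq pd h(1) Q(2) by blast
  moreover have "q * b \<in> P"
    unfolding e(2) by (rule submodD(3)[OF dom_primeD(1)[OF P(1)] h(1) pq(1)])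
  then have "b \<in> N"
    using dom_primeD(3)[OF P(1), of q b] pq pd h(2) P(2) by blast
  ultimately show False
    using coprime_not_both_in_prime[OF N h(3,4,7)] by blast
qed

text \<open>Comparing all maximal ideals with all except \<open>N\<close> gives some
  \<open>x\<close> that lies in every localization but the one at \<open>N\<close>. Its denominator
  in lowest terms is the required element. If \<open>N\<close> is the only maximal ideal, the second
  family is empty and \<open>0\<close> serves instead.\<close>

lemma sharp_isolating_element:
  assumes D: "bezout D" and sharp: "sharp_domain D" and N: "dom_maximal D N"
  obtains a where "a \<in> N" "\<And>N'. dom_maximal D N' \<Longrightarrow> a \<in> N' \<Longrightarrow> N' = N"
proof (cases "\<exists>N'. dom_maximal D N' \<and> N' \<noteq> N")
  case False
  have "0 \<in> N" using N unfolding dom_maximal_def dom_ideal_def by blast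
  then show ?thesis using that[of 0] False by blast
next
  case True
  note sD = bezout_subring[OF D]
  let ?M1 = "{M. dom_maximal D M}"
  let ?M2 = "{M. dom_maximal D M} - {N}"
  have "(\<Inter>M\<in>?M1. loc D M) \<noteq> (\<Inter>M\<in>?M2. loc D M)"
    by (rule sharp[unfolded sharp_domain_def, rule_format, of ?M1 ?M2]) (use True N in auto)
  then obtain x where x: "x \<notin> loc D N" "\<And>N'. dom_maximal D N' \<Longrightarrow> N' \<noteq> N \<Longrightarrow> x \<in> loc D N'"
    by auto
  obtain a b c d where h: "a \<in> D" "b \<in> D" "c \<in> D" "d \<in> D" "a \<noteq> 0" "x = b / a" "c * a + d * b = 1"
    using bezout_coprime_fraction[OF D] .
  show ?thesis
  proof (rule that)
    show "a \<in> N" using x(1) h(1,2,6) unfolding loc_iff by blast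
    fix N' assume N': "dom_maximal D N'" "a \<in> N'"
    have P: "dom_prime D N'" by (rule dom_maximal_prime[OF sD N'(1)])
    show "N' = N"
    proof (rule ccontr)
      assume "N' \<noteq> N"
      then obtain u s where us: "u \<in> D" "s \<in> D" "s \<notin> N'" "x = u / s"
        using x(2)[OF N'(1)] by (auto simp: loc_iff)
      have "s \<noteq> 0" using us(3) submodD(1)[OF dom_primeD(1)[OF P]] by auto
      then have "b * s = u * a" using h(5,6) us(4) by (simp add: field_simps)
      then have "b * s \<in> N'"
        using submodD(3)[OF dom_primeD(1)[OF P] us(1) N'(2)] by simp
      then have "b \<in> N'" using dom_primeD(3)[OF P h(2) us(2)] us(3) by blast
      then show False using coprime_not_both_in_prime[OF P h(3,4,7)] N'(2) by blast
    qed
  qed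
qed

text \<open>If \<open>c\<close> avoided every prime of the family, its inverse would lie in all the
  localizations and therefore in \<open>D\<close>.\<close>

lemma nonunit_in_some_prime:
  assumes D: "is_subring D" and Qs: "\<And>Q. Q \<in> \<Q> \<Longrightarrow> dom_prime D Q" "(\<Inter>Q\<in>\<Q>. loc D Q) = D" "\<Q> \<noteq> {}"
    and c: "c \<in> D" "inverse c \<notin> D \<or> c = 0"
  obtains Q where "Q \<in> \<Q>" "c \<in> Q"
proof (cases "c = 0")
  case True
  then show ?thesis
    using that Qs(1,3) submodD(1)[OF dom_primeD(1)] by blast
next
  case False
  then obtain Q where "Q \<in> \<Q>" "inverse c \<notin> loc D Q"
    using c(2) Qs(2) by blast
  then show ?thesis
    using that mem_prime_iff_loc[OF D Qs(1) c(1)] by blast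
qed

lemma inverse_not_in_ring:
  assumes "dom_prime D P" "c \<in> P"
  shows "inverse c \<notin> D \<or> c = 0"
proof (rule ccontr)
  assume "\<not> ?thesis"
  then have "inverse c * c \<in> P" "c \<noteq> 0"
    using submodD(3)[OF dom_primeD(1)[OF assms(1)] _ assms(2)] by blast+
  then show False using dom_primeD(4)[OF assms(1)] by simp
qed

section \<open>Representations of a Bezout domain by primes, near an isolated maximal ideal\<close>

context
  fixes D :: "'a::field set" and N a
  assumes D: "bezout D" and N: "dom_maximal D N" and a: "a \<in> N"
    and isolating: "\<And>N'. dom_maximal D N' \<Longrightarrow> a \<in> N' \<Longrightarrow> N' = N"
begin

text \<open>Every maximal ideal above \<open>P\<close> contains \<open>a\<close> and so can only be
  \<open>N\<close>.\<close>

lemma prime_below_isolated: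
  assumes P: "dom_prime D P" "a \<in> P"
  shows "P \<subseteq> N"
proof -
  obtain N' where "dom_maximal D N'" "P \<subseteq> N'"
    using proper_ideal_in_maximal[OF bezout_subring[OF D], of P] P(1) dom_primeD(4)[OF P(1)]
    unfolding dom_prime_def by blast
  then show ?thesis using isolating P(2) by blast
qed

lemma representing_prime_below_isolated:
  assumes Qs: "\<And>Q. Q \<in> \<Q> \<Longrightarrow> dom_prime D Q" "(\<Inter>Q\<in>\<Q>. loc D Q) = D" "\<Q> \<noteq> {}"
  obtains Q where "Q \<in> \<Q>" "a \<in> Q" "Q \<subseteq> N"
proof -
  have NP: "dom_prime D N" by (rule dom_maximal_prime[OF bezout_subring[OF D] N])
  obtain Q where "Q \<in> \<Q>" "a \<in> Q"
    using nonunit_in_some_prime[OF bezout_subring[OF D] Qs _ inverse_not_in_ring[OF NP a]] a dom_primeD(2)[OF NP] by blast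
  then show ?thesis using that prime_below_isolated Qs(1) by blast
qed

text \<open>A generator of \<open>(a, b)\<close> with \<open>b \<in> Q - P\<close> would avoid every member of \<open>\<Q>\<close>.\<close>

lemma representing_prime_not_below:
  assumes Qs: "\<And>Q. Q \<in> \<Q> \<Longrightarrow> dom_prime D Q" "(\<Inter>Q\<in>\<Q>. loc D Q) = D" "pairwise_incomparable \<Q>"
    and P: "P \<in> \<Q>" "P \<subseteq> N" and Q: "dom_prime D Q" "P \<subseteq> Q"
  shows "Q = P"
proof (rule ccontr)
  assume "Q \<noteq> P"
  then obtain b where b: "b \<in> Q" "b \<notin> P" using Q(2) by blast
  have NP: "dom_prime D N" by (rule dom_maximal_prime[OF bezout_subring[OF D] N])
  have ne: "\<Q> \<noteq> {}" using P(1) by blast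
  \<comment> \<open>A member containing \<open>a\<close> lies below \<open>N\<close>, where primes
    form a chain; incomparability leaves only \<open>P\<close>.\<close>
  have uniq: "P' = P" if "P' \<in> \<Q>" "a \<in> P'" for P'
  proof -
    have "P' \<subseteq> P \<or> P \<subseteq> P'"
      using bezout_primes_comparable[OF D NP Qs(1)[OF that(1)] _ Qs(1)[OF P(1)] P(2)]
        prime_below_isolated[OF Qs(1)[OF that(1)] that(2)] by blast
    then show ?thesis using Qs(3) that(1) P(1) unfolding pairwise_incomparable_def by blast
  qed
  obtain P' where "P' \<in> \<Q>" "a \<in> P'"
    using representing_prime_below_isolated[OF Qs(1,2) ne] by blast
  then have aP: "a \<in> P" using uniq by blast
  obtain c u v r s where c: "u \<in> D" "v \<in> D" "r \<in> D" "s \<in> D" "a = u * c" "b = v * c" "c = r * a + s * b"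
    by (rule bezoutE[OF D])
  note sQ = submodD[OF dom_primeD(1)[OF Q(1)]]
  have "r * a + s * b \<in> Q"
    using sQ(2)[OF sQ(3)[OF c(3)] sQ(3)[OF c(4) b(1)]] aP Q(2) by blast
  then have cQ: "c \<in> Q" using c(7) by simp
  then have "c \<in> D" using dom_primeD(2)[OF Q(1)] by blast
  then obtain P' where P': "P' \<in> \<Q>" "c \<in> P'"
    using nonunit_in_some_prime[OF bezout_subring[OF D] Qs(1,2) ne _ inverse_not_in_ring[OF Q(1) cQ]] by blast
  note sP' = submodD[OF dom_primeD(1)[OF Qs(1)[OF P'(1)]]]
  have "a \<in> P'" "b \<in> P'"
    using sP'(3)[OF c(1) P'(2)] sP'(3)[OF c(2) P'(2)] c(5,6) by simp_all
  then show False using uniq P'(1) b(2) by blast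
qed

end

text \<open>Take an isolated maximal ideal \<open>N\<close> above \<open>P\<close> and a member
  \<open>Q\<close> of the other family below \<open>N\<close>. They are comparable, and
  \<open>representing_prime_not_below\<close>, applied to the family of the smaller one, makes them
  equal.\<close>

lemma bezout_sharp_representation_subset:
  assumes D: "bezout D" "sharp_domain D"
    and Ps: "\<And>P. P \<in> \<P> \<Longrightarrow> dom_prime D P" "(\<Inter>P\<in>\<P>. loc D P) = D" "pairwise_incomparable \<P>"
    and Qs: "\<And>Q. Q \<in> \<Q> \<Longrightarrow> dom_prime D Q" "(\<Inter>Q\<in>\<Q>. loc D Q) = D" "pairwise_incomparable \<Q>" "\<Q> \<noteq> {}"
  shows "\<P> \<subseteq> \<Q>"
proof
  fix P assume P: "P \<in> \<P>"
  note sD = bezout_subring[OF D(1)]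
  obtain N where N: "dom_maximal D N" "P \<subseteq> N"
    using proper_ideal_in_maximal[OF sD, of P] Ps(1)[OF P] dom_primeD(4)[OF Ps(1)[OF P]]
    unfolding dom_prime_def by blast
  have NP: "dom_prime D N" by (rule dom_maximal_prime[OF sD N(1)])
  obtain a where a: "a \<in> N" "\<And>N'. dom_maximal D N' \<Longrightarrow> a \<in> N' \<Longrightarrow> N' = N"
    using sharp_isolating_element[OF D N(1)] by blast
  obtain Q where Q: "Q \<in> \<Q>" "Q \<subseteq> N"
    using representing_prime_below_isolated[OF D(1) N(1) a Qs(1,2,4)] by blast
  have "P \<subseteq> Q \<or> Q \<subseteq> P"
    by (rule bezout_primes_comparable[OF D(1) NP Ps(1)[OF P] N(2) Qs(1)[OF Q(1)] Q(2)])
  then have "P = Q"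
    using representing_prime_not_below[OF D(1) N(1) a Ps P N(2) Qs(1)[OF Q(1)]]
      representing_prime_not_below[OF D(1) N(1) a Qs(1,2,3) Q Ps(1)[OF P]] by blast
  then show "P \<in> \<Q>" using Q(1) by simp
qed

text \<open>The preceding lemma needs families of primes of the represented ring itself. Both
  families are therefore lifted from \<open>D\<close> to \<open>T\<close>, compared there, and
  contracted back.\<close>

lemma bezout_sharp_Inter_loc_eq_imp_eq:
  assumes D: "bezout D"
    and Ps: "\<And>P. P \<in> \<P> \<Longrightarrow> dom_prime D P" "pairwise_incomparable \<P>" "\<P> \<noteq> {}"
    and Qs: "\<And>Q. Q \<in> \<Q> \<Longrightarrow> dom_prime D Q" "pairwise_incomparable \<Q>" "\<Q> \<noteq> {}"
    and eq: "(\<Inter>P\<in>\<P>. loc D P) = T" "(\<Inter>Q\<in>\<Q>. loc D Q) = T"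
    and sharp: "sharp_domain T"
  shows "\<P> = \<Q>"
proof -
  note sD = bezout_subring[OF D]
  have "is_subring T"
    unfolding eq(1)[symmetric] is_subring_def
    using is_subringD[OF is_subring_loc[OF sD Ps(1)]] by (intro conjI ballI) auto
  moreover have "D \<subseteq> T"
    unfolding eq(1)[symmetric] using loc_superset[OF Ps(1) sD] by blast
  ultimately have T: "overring D T" unfolding overring_def by blast
  \<comment> \<open>The prime of \<open>T\<close> lying over \<open>P\<close>. It is a prime with
    the same localization because \<open>T \<subseteq> loc D P\<close> for every member of either
    family.\<close>
  define F where "F = (\<lambda>P. max_of_loc D P \<inter> T)"
  have F: "dom_prime T (F P)" "F P \<inter> D = P" "loc T (F P) = loc D P" if P: "dom_prime D P" "T \<subseteq> loc D P" for P
  proof -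
    show p: "dom_prime T (F P)"
      unfolding F_def by (rule dom_prime_restrict[OF dom_prime_max_of_loc[OF sD P(1)] \<open>is_subring T\<close> P(2)])
    show r: "F P \<inter> D = P"
      using max_of_loc_restrict[OF sD P(1)] \<open>D \<subseteq> T\<close> unfolding F_def by blast
    show "loc T (F P) = loc D P"
      using bezout_loc_overring[OF D T p] r by simp
  qed
  have main: "(\<forall>P\<in>F ` \<R>. dom_prime T P) \<and> (\<Inter>P\<in>F ` \<R>. loc T P) = T \<and> pairwise_incomparable (F ` \<R>) \<and> (\<lambda>P. P \<inter> D) ` F ` \<R> = \<R>"
    if R: "\<And>P. P \<in> \<R> \<Longrightarrow> dom_prime D P" "pairwise_incomparable \<R>" "(\<Inter>P\<in>\<R>. loc D P) = T" for \<R>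
  proof -
    have FR: "dom_prime T (F P)" "F P \<inter> D = P" "loc T (F P) = loc D P" if "P \<in> \<R>" for P
      using F[OF R(1)[OF that]] R(3) that by blast+
    have "(\<lambda>P. P \<inter> D) ` F ` \<R> = \<R>"
      unfolding image_image using FR(2) by simp
    moreover have "(\<Inter>P\<in>F ` \<R>. loc T P) = T"
      unfolding image_image using FR(3) R(3) by simp
    moreover have "P = Q" if "P \<in> \<R>" "Q \<in> \<R>" "F P \<subseteq> F Q" for P Q
    proof -
      have "F P \<inter> D \<subseteq> F Q \<inter> D" using that(3) by blast
      then have "P \<subseteq> Q" unfolding FR(2)[OF that(1)] FR(2)[OF that(2)] .
      then show ?thesis using that R(2) unfolding pairwise_incomparable_def by blast
    qed
    then have "pairwise_incomparable (F ` \<R>)"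
      unfolding pairwise_incomparable_def by blast
    ultimately show ?thesis using FR(1) by blast
  qed
  note m1 = main[OF Ps(1,2) eq(1)] and m2 = main[OF Qs(1,2) eq(2)]
  note bT = bezout_overring[OF D T]
  have "F ` \<P> \<subseteq> F ` \<Q>"
    by (rule bezout_sharp_representation_subset[OF bT sharp]) (use m1 m2 Qs(3) in auto)
  moreover have "F ` \<Q> \<subseteq> F ` \<P>"
    by (rule bezout_sharp_representation_subset[OF bT sharp]) (use m1 m2 Ps(3) in auto)
  ultimately have "(\<lambda>P. P \<inter> D) ` F ` \<P> = (\<lambda>P. P \<inter> D) ` F ` \<Q>" by simp
  then show ?thesis using m1 m2 by simp
qed

section \<open>The t-operation\<close>

lemma v_op_generated: "is_subring R \<Longrightarrow> v_op R (mod_prod R S) = v_op R S"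
  unfolding v_op_def by (simp add: colon_generated)

lemma v_op_extensive: "S \<subseteq> v_op R S"
  unfolding v_op_def colon_def by (auto simp: mult.commute)

text \<open>The colon is an antitone Galois connection with itself, so a triple colon reduces to a
  single one.\<close>

lemma colon_v_op: "colon R (v_op R S) = colon R S"
proof
  show "colon R (v_op R S) \<subseteq> colon R S"
    using v_op_extensive[of S R] unfolding colon_def by blast
  show "colon R S \<subseteq> colon R (v_op R S)"
    using v_op_extensive[of "colon R S" R] unfolding v_op_def .
qed

lemma v_op_mono: "S \<subseteq> T \<Longrightarrow> v_op R S \<subseteq> v_op R T"
  unfolding v_op_def colon_def by blast

lemma v_op_least: "S \<subseteq> v_op R T \<Longrightarrow> v_op R S \<subseteq> v_op R T"
  using v_op_mono[of S "v_op R T" R] colon_v_op[of R T] unfolding v_op_def by simp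

lemma submod_v_op: "is_subring R \<Longrightarrow> submod R (v_op R S)"
  unfolding v_op_def by (rule submod_colon)

lemma v_op_scale:
  assumes "x \<in> v_op R S"
  shows "b * x \<in> v_op R ((*) b ` S)"
proof -
  have "b * x * y \<in> R" if "y \<in> colon R ((*) b ` S)" for y
  proof -
    have "y * b \<in> colon R S"
      using that unfolding colon_def by (auto simp: mult.assoc)
    then have "x * (y * b) \<in> R"
      using assms unfolding v_op_def colon_def by blast
    then show ?thesis by (simp add: ac_simps)
  qed
  then show ?thesis unfolding v_op_def by (subst (1) colon_def) blast
qed

lemma generated_eq_zero_iff:
  assumes "is_subring R"
  shows "mod_prod R S = {0} \<longleftrightarrow> S \<subseteq> {0}"
proof -
  have "submod R {0}" unfolding submod_def by auto
  then have "mod_prod R S \<subseteq> {0} \<longleftrightarrow> S \<subseteq> {0}" by (rule generated_subset_iff[OF assms])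
  then show ?thesis using mod_prod_zero[of R S] by blast
qed

text \<open>A set and the module it generates have the same v-closure, so finitely generated
  submodules can be replaced by finite sets. The condition \<open>\<not> S \<subseteq> {0}\<close>
  says that the generated module is nonzero.\<close>

lemma mem_t_op_iff:
  assumes "is_subring R" "submod R A"
  shows "x \<in> t_op R A \<longleftrightarrow> (\<exists>S. finite S \<and> S \<subseteq> A \<and> \<not> S \<subseteq> {0} \<and> x \<in> v_op R S)"
proof
  assume "x \<in> t_op R A"
  then obtain J where J: "fin_gen_nonzero R J" "J \<subseteq> A" "x \<in> v_op R J"
    unfolding t_op_def by blast
  then obtain S where S: "finite S" "J = mod_prod R S" "J \<noteq> {0}"
    unfolding fin_gen_nonzero_def by blast
  have "S \<subseteq> A" using generated_superset[OF assms(1), of S] S(2) J(2) by simp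
  moreover have "\<not> S \<subseteq> {0}" using generated_eq_zero_iff[OF assms(1), of S] S by simp
  moreover have "x \<in> v_op R S" using v_op_generated[OF assms(1), of S] J(3) S(2) by simp
  ultimately show "\<exists>S. finite S \<and> S \<subseteq> A \<and> \<not> S \<subseteq> {0} \<and> x \<in> v_op R S" using S(1) by blast
next
  assume "\<exists>S. finite S \<and> S \<subseteq> A \<and> \<not> S \<subseteq> {0} \<and> x \<in> v_op R S"
  then obtain S where S: "finite S" "S \<subseteq> A" "\<not> S \<subseteq> {0}" "x \<in> v_op R S" by blast
  have "fin_gen_nonzero R (mod_prod R S)"
    unfolding fin_gen_nonzero_def using S(1,3) generated_eq_zero_iff[OF assms(1), of S] by blast
  moreover have "mod_prod R S \<subseteq> A" using generated_subset_iff[OF assms] S(2) by blast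
  moreover have "x \<in> v_op R (mod_prod R S)" using v_op_generated[OF assms(1)] S(4) by simp
  ultimately show "x \<in> t_op R A" unfolding t_op_def by blast
qed

lemma t_op_mono: "A \<subseteq> B \<Longrightarrow> t_op R A \<subseteq> t_op R B"
  unfolding t_op_def by blast

lemma t_op_extensive:
  assumes "is_subring R" "submod R A" "A \<noteq> {0}"
  shows "A \<subseteq> t_op R A"
proof
  fix x assume "x \<in> A"
  obtain a where "a \<in> A" "a \<noteq> 0" using assms(3) submodD(1)[OF assms(2)] by blast
  then have "finite {x, a}" "{x, a} \<subseteq> A" "\<not> {x, a} \<subseteq> {0}" "x \<in> v_op R {x, a}"
    using \<open>x \<in> A\<close> v_op_extensive[of "{x, a}" R] by auto
  then show "x \<in> t_op R A" using mem_t_op_iff[OF assms(1,2)] by blast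
qed

text \<open>Finite character: the finite sets witnessing the single elements are merged into one.
  For empty \<open>S\<close> a nonzero element of \<open>A\<close> still has to be supplied.\<close>

lemma t_op_finite_subset:
  assumes "is_subring R" "submod R A" "A \<noteq> {0}" "finite S" "S \<subseteq> t_op R A"
  obtains F where "finite F" "F \<subseteq> A" "\<not> F \<subseteq> {0}" "S \<subseteq> v_op R F"
proof -
  have "\<exists>F. finite F \<and> F \<subseteq> A \<and> \<not> F \<subseteq> {0} \<and> S \<subseteq> v_op R F"
    using assms(4,5)
  proof (induction S rule: finite_induct)
    case empty
    obtain a where "a \<in> A" "a \<noteq> 0" using assms(3) submodD(1)[OF assms(2)] by blast
    then show ?case by (intro exI[of _ "{a}"]) auto
  next
    case (insert x S)
    then obtain F where F: "finite F" "F \<subseteq> A" "\<not> F \<subseteq> {0}" "S \<subseteq> v_op R F" by blast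
    obtain G where G: "finite G" "G \<subseteq> A" "x \<in> v_op R G"
      using insert.prems mem_t_op_iff[OF assms(1,2)] by blast
    have "insert x S \<subseteq> v_op R (F \<union> G)"
      using F(4) G(3) v_op_mono[of F "F \<union> G" R] v_op_mono[of G "F \<union> G" R] by blast
    then show ?case using F G by (intro exI[of _ "F \<union> G"]) auto
  qed
  then show ?thesis using that by blast
qed

lemma submod_t_op:
  assumes "is_subring R" "submod R A" "A \<noteq> {0}"
  shows "submod R (t_op R A)"
  unfolding submod_def
proof (intro conjI ballI)
  note iff = mem_t_op_iff[OF assms(1,2)]
  show "0 \<in> t_op R A" using t_op_extensive[OF assms] submodD(1)[OF assms(2)] by blast
  fix x assume x: "x \<in> t_op R A"
  show "x + y \<in> t_op R A" if "y \<in> t_op R A" for y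
  proof -
    obtain F where F: "finite F" "F \<subseteq> A" "\<not> F \<subseteq> {0}" "{x, y} \<subseteq> v_op R F"
      using t_op_finite_subset[OF assms, of "{x, y}"] x \<open>y \<in> t_op R A\<close> by blast
    then have "x + y \<in> v_op R F" using submodD(2)[OF submod_v_op[OF assms(1)]] by simp
    then show ?thesis using F iff by blast
  qed
  show "r * x \<in> t_op R A" if "r \<in> R" for r
    using x that submodD(3)[OF submod_v_op[OF assms(1)]] unfolding iff by blast
qed

text \<open>A finite subset of the t-closure lies in one v-closure of a finite
  \<open>F \<subseteq> A\<close>, which absorbs the v-closure of that subset.\<close>

lemma t_op_idem:
  assumes "is_subring R" "submod R A" "A \<noteq> {0}"
  shows "t_op R (t_op R A) = t_op R A"
proof
  have t: "submod R (t_op R A)" by (rule submod_t_op[OF assms])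
  have ne: "t_op R A \<noteq> {0}" using t_op_extensive[OF assms] assms(3) submodD(1)[OF assms(2)] by blast
  show "t_op R A \<subseteq> t_op R (t_op R A)" by (rule t_op_extensive[OF assms(1) t ne])
  show "t_op R (t_op R A) \<subseteq> t_op R A"
  proof
    fix x assume "x \<in> t_op R (t_op R A)"
    then obtain S where S: "finite S" "S \<subseteq> t_op R A" "x \<in> v_op R S"
      using mem_t_op_iff[OF assms(1) t] by blast
    obtain F where F: "finite F" "F \<subseteq> A" "\<not> F \<subseteq> {0}" "S \<subseteq> v_op R F"
      using t_op_finite_subset[OF assms S(1,2)] by blast
    then show "x \<in> t_op R A" using v_op_least[OF F(4)] S(3) mem_t_op_iff[OF assms(1,2)] by blast
  qed
qed

lemma t_op_subset_ring:
  assumes "is_subring R" "A \<subseteq> R"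
  shows "t_op R A \<subseteq> R"
proof
  fix x assume "x \<in> t_op R A"
  then obtain J where J: "J \<subseteq> A" "x \<in> v_op R J" unfolding t_op_def by blast
  have "1 \<in> colon R J" using assms(2) J(1) unfolding colon_def by auto
  then have "x * 1 \<in> R" using J(2) unfolding v_op_def by (subst (asm) (1) colon_def) blast
  then show "x \<in> R" by simp
qed

lemma t_ideal_t_op:
  assumes "is_subring R" "dom_ideal R A" "A \<noteq> {0}"
  shows "t_ideal R (t_op R A)"
proof -
  have A: "submod R A" "A \<subseteq> R" using assms(2) by (auto simp: dom_ideal_iff_submod)
  show ?thesis
    unfolding t_ideal_def dom_ideal_iff_submod
    using submod_t_op[OF assms(1) A(1) assms(3)] t_op_subset_ring[OF assms(1) A(2)]
      t_op_idem[OF assms(1) A(1) assms(3)] t_op_extensive[OF assms(1) A(1) assms(3)]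
      assms(3) submodD(1)[OF A(1)] by blast
qed

text \<open>Zorn's lemma applies because of finite character: a finite subset of the union of a
  chain lies in one member, and so does its v-closure. Hence the union is again a t-ideal.\<close>

lemma proper_t_ideal_in_t_Max:
  assumes R: "is_subring R" and A: "dom_ideal R A" "A \<noteq> {0}" and ne: "t_op R A \<noteq> R"
  obtains M where "M \<in> t_Max R" "A \<subseteq> M"
proof -
  let ?A = "{J. t_ideal R J \<and> 1 \<notin> J \<and> A \<subseteq> J}"
  have one: "J \<noteq> R \<longleftrightarrow> 1 \<notin> J" if "t_ideal R J" for J
    using that proper_ideal_iff is_subringD(2)[OF R] unfolding t_ideal_def by blast
  have sub: "A \<subseteq> t_op R A"
    using A by (intro t_op_extensive[OF R]) (auto simp: dom_ideal_iff_submod)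
  have "\<exists>M\<in>?A. \<forall>X\<in>?A. M \<subseteq> X \<longrightarrow> X = M"
  proof (rule subset_Zorn_nonempty)
    show "?A \<noteq> {}" using t_ideal_t_op[OF R A] ne one sub by blast
    fix \<C> assume C: "\<C> \<noteq> {}" "subset.chain ?A \<C>"
    then have sub: "\<C> \<subseteq> ?A" by (simp add: subset.chain_def)
    have sm: "submod R (\<Union>\<C>)"
      using submod_Union_chain[OF C(2,1)] sub by (auto simp: dom_ideal_iff_submod t_ideal_def)
    have ne0: "\<Union>\<C> \<noteq> {0}"
    proof -
      have "A \<subseteq> \<Union>\<C>" using sub C(1) by blast
      moreover have "0 \<in> A" using A(1) unfolding dom_ideal_def by blast
      ultimately show ?thesis using A(2) by blast
    qed
    have "t_op R (\<Union>\<C>) \<subseteq> \<Union>\<C>"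
    proof
      fix x assume "x \<in> t_op R (\<Union>\<C>)"
      then obtain S where S: "finite S" "S \<subseteq> \<Union>\<C>" "\<not> S \<subseteq> {0}" "x \<in> v_op R S"
        unfolding mem_t_op_iff[OF R sm] by (elim exE conjE)
      have "\<exists>B\<in>\<C>. S \<subseteq> B"
        using S(1,2)
      proof (induction S rule: finite_induct)
        case empty
        then show ?case using C(1) by blast
      next
        case (insert y S)
        then obtain B B' where B: "B \<in> \<C>" "S \<subseteq> B" "B' \<in> \<C>" "y \<in> B'" by auto
        have "B \<subseteq> B' \<or> B' \<subseteq> B"
          using C(2) B(1,3) unfolding subset_chain_def by simp
        then show ?case using B by blast
      qed
      then obtain B where B: "B \<in> \<C>" "S \<subseteq> B" by blast
      then have tB: "t_ideal R B" using sub by blast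
      then have "submod R B" by (simp add: t_ideal_def dom_ideal_iff_submod)
      then have "x \<in> t_op R B" using mem_t_op_iff[OF R] S B(2) by blast
      then show "x \<in> \<Union>\<C>" using tB B(1) unfolding t_ideal_def by auto
    qed
    then have "t_ideal R (\<Union>\<C>)"
      using t_op_extensive[OF R sm ne0] sm ne0 sub
      unfolding t_ideal_def dom_ideal_iff_submod by auto
    then show "\<Union>\<C> \<in> ?A" using sub C(1) by auto
  qed
  then obtain M where M: "M \<in> ?A" "\<forall>X\<in>?A. M \<subseteq> X \<longrightarrow> X = M" by (rule bexE)
  have "M \<in> t_Max R"
    unfolding t_Max_def
  proof (intro CollectI conjI allI impI)
    show "t_ideal R M" "M \<noteq> R" using M(1) one by auto
    fix J assume J: "t_ideal R J \<and> M \<subseteq> J \<and> J \<noteq> R"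
    then have "J \<in> ?A" using M(1) one by auto
    then show "J = M" using M(2) J by simp
  qed
  then show ?thesis using M(1) by (intro that) auto
qed

lemma t_op_subset_t_ideal: "t_ideal R I \<Longrightarrow> A \<subseteq> I \<Longrightarrow> t_op R A \<subseteq> I"
  using t_op_mono[of A I R] unfolding t_ideal_def by simp

lemma t_Max_t_ideal: "M \<in> t_Max R \<Longrightarrow> t_ideal R M"
  unfolding t_Max_def by blast

text \<open>For \<open>a \<notin> M\<close> the t-closure of \<open>M + R a\<close> is
  \<open>R\<close>, so \<open>1\<close> lies in the v-closure of a finite \<open>S\<close> in this
  ideal. Scaling by \<open>b\<close> moves \<open>S\<close> into \<open>M\<close> when
  \<open>a * b \<in> M\<close>, and puts \<open>b\<close> into the t-closure of
  \<open>M\<close>.\<close>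

lemma t_Max_prime:
  assumes R: "is_subring R" and M: "M \<in> t_Max R"
  shows "dom_prime R M"
proof -
  have t: "t_ideal R M" "M \<noteq> R" using M unfolding t_Max_def by auto
  then have id: "dom_ideal R M" and ne: "M \<noteq> {0}" unfolding t_ideal_def by auto
  have sM: "submod R M" "M \<subseteq> R" using id by (auto simp: dom_ideal_iff_submod)
  have "b \<in> M" if ab: "a \<in> R" "b \<in> R" "a * b \<in> M" "a \<notin> M" for a b
  \<comment> \<open>For \<open>b = 0\<close> the scaled set would be zero and could not witness
    membership in a t-closure.\<close>
  proof (cases "b = 0")
    case True
    then show ?thesis using submodD(1)[OF sM(1)] by simp
  next
    case b: False
    let ?J = "{m + d * a | m d. m \<in> M \<and> d \<in> R}"
    have J: "dom_ideal R ?J" by (rule ideal_adjoin[OF R id ab(1)])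
    have MJ: "M \<subseteq> ?J" using is_subringD(1)[OF R] by force
    have aJ: "a \<in> ?J" using is_subringD(2)[OF R] submodD(1)[OF sM(1)] by force
    have Jne: "?J \<noteq> {0}" using MJ ne submodD(1)[OF sM(1)] by blast
    have sJ: "submod R ?J" using J by (simp add: dom_ideal_iff_submod)
    have Jt: "?J \<subseteq> t_op R ?J" by (rule t_op_extensive[OF R sJ Jne])
    have "t_op R ?J = R"
    proof (rule ccontr)
      assume "t_op R ?J \<noteq> R"
      moreover have "M \<subseteq> t_op R ?J" using MJ Jt by (rule subset_trans)
      ultimately have "t_op R ?J = M"
        using M t_ideal_t_op[OF R J Jne] unfolding t_Max_def by simp
      then show False using Jt aJ ab(4) by blast
    qed
    then have "1 \<in> t_op R ?J" using is_subringD(2)[OF R] by simp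
    then obtain S where S: "finite S" "S \<subseteq> ?J" "\<not> S \<subseteq> {0}" "1 \<in> v_op R S"
      unfolding mem_t_op_iff[OF R sJ] by (elim exE conjE)
    have "(*) b ` S \<subseteq> M"
    proof
      fix y assume "y \<in> (*) b ` S"
      then obtain s where s: "y = b * s" "s \<in> ?J" using S(2) by blast
      then obtain m d where md: "y = b * (m + d * a)" "m \<in> M" "d \<in> R" by blast
      have "y = b * m + d * (a * b)" unfolding md(1) by (simp add: algebra_simps)
      then show "y \<in> M" using md(2,3) ab submodD(2,3)[OF sM(1)] by simp
    qed
    moreover have "\<not> (*) b ` S \<subseteq> {0}" using S(3) b by auto
    moreover have "b * 1 \<in> v_op R ((*) b ` S)" by (rule v_op_scale[OF S(4)])
    ultimately have "b \<in> t_op R M"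
      using mem_t_op_iff[OF R sM(1)] S(1) by (metis finite_imageI mult.right_neutral)
    then show ?thesis using t(1) unfolding t_ideal_def by simp
  qed
  then show ?thesis unfolding dom_prime_def using id t(2) by blast
qed

section \<open>Extensions in which every element has a content\<close>

text \<open>In the intended instance \<open>\<iota>\<close> embeds the constants \<open>K\<close>
  into \<open>K(X)\<close> and \<open>D\<close> is the t-Nagata ring. The last three assumptions
  identify the principal \<open>D\<close>-submodules with those generated by finitely many
  constants, and say that taking constants of the latter amounts to the v-operation of
  \<open>R\<close>.\<close>

locale content_extension =
  fixes \<iota> :: "'k::field \<Rightarrow> 'l::field" and R :: "'k set" and D :: "'l set"
  assumes hom_add: "\<iota> (x + y) = \<iota> x + \<iota> y"
    and hom_mult: "\<iota> (x * y) = \<iota> x * \<iota> y"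
    and hom_one: "\<iota> 1 = 1"
    and ring_R: "is_subring R"
    and ring_D: "is_subring D"
    and principal_has_content: "\<exists>S. finite S \<and> mod_prod D {z} = mod_prod D (\<iota> ` S)"
    and finitely_generated_principal: "finite S \<Longrightarrow> \<exists>z. mod_prod D (\<iota> ` S) = mod_prod D {z}"
    and contraction_v_op: "finite S \<Longrightarrow> \<not> S \<subseteq> {0} \<Longrightarrow> \<iota> x \<in> mod_prod D (\<iota> ` S) \<longleftrightarrow> x \<in> v_op R S"
begin

definition ext :: "'k set \<Rightarrow> 'l set" where
  "ext A = mod_prod D (\<iota> ` A)"

definition con :: "'l set \<Rightarrow> 'k set" where
  "con N = {x. \<iota> x \<in> N}"

lemma hom_zero: "\<iota> 0 = 0"
  using hom_add[of 0 0] by (metis add.right_neutral add_left_cancel)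

lemma hom_eq_zero_iff: "\<iota> x = 0 \<longleftrightarrow> x = 0"
proof
  show "x = 0" if "\<iota> x = 0"
  proof (rule ccontr)
    assume "x \<noteq> 0"
    then have "\<iota> x * \<iota> (inverse x) = 1" using hom_mult[of x "inverse x"] hom_one by simp
    then show False using that by simp
  qed
qed (simp add: hom_zero)

lemma hom_divide: "y \<noteq> 0 \<Longrightarrow> \<iota> (x / y) = \<iota> x / \<iota> y"
  using hom_mult[of "x / y" y] hom_eq_zero_iff[of y] by (simp add: field_simps)

lemma hom_power: "\<iota> (x ^ n) = \<iota> x ^ n"
  by (induction n) (simp_all add: hom_one hom_mult)

lemma submod_ext: "submod D (ext A)"
  unfolding ext_def by (rule submod_generated[OF ring_D])

lemma ext_subset_iff: "submod D N \<Longrightarrow> ext A \<subseteq> N \<longleftrightarrow> A \<subseteq> con N"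
  unfolding ext_def con_def using generated_subset_iff[OF ring_D] by auto

lemma con_ext_superset: "A \<subseteq> con (ext A)"
  using ext_subset_iff[OF submod_ext] by blast

lemma ext_mono: "A \<subseteq> B \<Longrightarrow> ext A \<subseteq> ext B"
  unfolding ext_def by (intro mod_prod_mono) auto

lemma con_mono: "N \<subseteq> N' \<Longrightarrow> con N \<subseteq> con N'"
  unfolding con_def by blast

text \<open>The case \<open>S = {1}\<close> of \<open>contraction_v_op\<close>: the generated module
  is \<open>D\<close>, and the v-closure of \<open>{1}\<close> is \<open>R\<close>.\<close>

lemma con_ring: "con D = R"
proof -
  have "mod_prod D {1} = D" unfolding generated_singleton[OF ring_D] by simp
  then have "\<iota> x \<in> D \<longleftrightarrow> x \<in> v_op R {1}" for x
    using contraction_v_op[of "{1}" x] hom_one by simp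
  moreover have "colon R {1} = R" unfolding colon_def by simp
  moreover have "colon R R = R"
  proof
    show "colon R R \<subseteq> R" using is_subringD(2)[OF ring_R] unfolding colon_def by force
    show "R \<subseteq> colon R R" using is_subringD(5)[OF ring_R] unfolding colon_def by blast
  qed
  ultimately show ?thesis unfolding con_def v_op_def by simp
qed

lemma hom_mem_ring_iff: "\<iota> x \<in> D \<longleftrightarrow> x \<in> R"
  using con_ring unfolding con_def by blast

text \<open>The working form of the content of \<open>z\<close>: one finite set of constants tests
  membership of \<open>z\<close> in all \<open>D\<close>-submodules at once. That its elements are
  \<open>D\<close>-multiples of \<open>z\<close> lets relations on \<open>z\<close> descend to
  constants.\<close>

lemma content:
  obtains S where "finite S" "\<forall>N. submod D N \<longrightarrow> (z \<in> N \<longleftrightarrow> S \<subseteq> con N)" "\<forall>s\<in>S. \<exists>d\<in>D. \<iota> s = d * z"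
proof -
  obtain S where S: "finite S" "mod_prod D {z} = mod_prod D (\<iota> ` S)"
    using principal_has_content by blast
  have "z \<in> N \<longleftrightarrow> S \<subseteq> con N" if "submod D N" for N
    using generated_subset_iff[OF ring_D that, of "{z}"] generated_subset_iff[OF ring_D that, of "\<iota> ` S"] S(2)
    unfolding con_def by auto
  moreover have "\<exists>d\<in>D. \<iota> s = d * z" if "s \<in> S" for s
  proof -
    have "\<iota> s \<in> mod_prod D {z}"
      using S(2) generated_superset[OF ring_D, of "\<iota> ` S"] that by blast
    then show ?thesis unfolding generated_singleton[OF ring_D] by blast
  qed
  ultimately show ?thesis using that S(1) by blast
qed

text \<open>An element of \<open>N\<close> is generated by its content, and this content consists of
  constants of \<open>N\<close>. So contraction is injective on \<open>D\<close>-submodules.\<close>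

lemma ext_con:
  assumes "submod D N"
  shows "ext (con N) = N"
proof
  show "ext (con N) \<subseteq> N" using ext_subset_iff[OF assms] by blast
  show "N \<subseteq> ext (con N)"
  proof
    fix z assume z: "z \<in> N"
    obtain S where S: "finite S" "\<forall>N. submod D N \<longrightarrow> (z \<in> N \<longleftrightarrow> S \<subseteq> con N)" "\<forall>s\<in>S. \<exists>d\<in>D. \<iota> s = d * z"
      by (rule content[of z])
    then have "S \<subseteq> con N" using S(2)[rule_format, OF assms] z by blast
    then have "S \<subseteq> con (ext (con N))" using con_ext_superset[of "con N"] by blast
    then show "z \<in> ext (con N)" using S(2)[rule_format, OF submod_ext] by blast
  qed
qed

lemma con_inject: "submod D N \<Longrightarrow> submod D N' \<Longrightarrow> con N = con N' \<longleftrightarrow> N = N'"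
  using ext_con by metis

lemma con_subset_iff: "submod D N \<Longrightarrow> submod D N' \<Longrightarrow> con N \<subseteq> con N' \<longleftrightarrow> N \<subseteq> N'"
  using ext_con ext_mono con_mono by metis

lemma submod_con: "submod D N \<Longrightarrow> submod R (con N)"
  unfolding submod_def con_def using hom_mem_ring_iff by (auto simp: hom_zero hom_add hom_mult)

lemma con_eq_zero_iff:
  assumes "submod D N"
  shows "con N = {0} \<longleftrightarrow> N = {0}"
proof -
  have "con {0} = {0}" unfolding con_def by (simp add: hom_eq_zero_iff)
  moreover have "submod D {0}" unfolding submod_def by auto
  ultimately show ?thesis using con_inject[OF assms] by metis
qed

lemma con_ext:
  assumes A: "submod R A" "A \<noteq> {0}"
  shows "con (ext A) = t_op R A"
proof
  obtain a where a: "a \<in> A" "a \<noteq> 0" using A submodD(1)[OF A(1)] by blast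
  show "con (ext A) \<subseteq> t_op R A"
  proof
    fix x assume "x \<in> con (ext A)"
    then have "\<iota> x \<in> mod_prod D (\<iota> ` A)" unfolding con_def ext_def by simp
    then obtain S' where S': "finite S'" "S' \<subseteq> \<iota> ` A" "\<iota> x \<in> mod_prod D S'"
      by (rule generated_finite[OF ring_D])
    then obtain S where S: "finite S" "S \<subseteq> A" "S' = \<iota> ` S" by (meson finite_subset_image)
    \<comment> \<open>The nonzero \<open>a\<close> is added because \<open>contraction_v_op\<close>
      demands a set other than zero.\<close>
    have "\<iota> x \<in> mod_prod D (\<iota> ` insert a S)"
      using S'(3) S(3) mod_prod_mono[of D D S' "\<iota> ` insert a S"] by blast
    moreover have "\<not> insert a S \<subseteq> {0}" using a by blast
    ultimately have "x \<in> v_op R (insert a S)"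
      using contraction_v_op[of "insert a S" x] S(1) by blast
    then show "x \<in> t_op R A"
      using mem_t_op_iff[OF ring_R A(1)] S(1,2) a by blast
  qed
  show "t_op R A \<subseteq> con (ext A)"
  proof
    fix x assume "x \<in> t_op R A"
    then obtain S where S: "finite S" "S \<subseteq> A" "\<not> S \<subseteq> {0}" "x \<in> v_op R S"
      unfolding mem_t_op_iff[OF ring_R A(1)] by (elim exE conjE)
    then have "x \<in> con (ext S)" using contraction_v_op[OF S(1,3)] by (simp add: con_def ext_def)
    then show "x \<in> con (ext A)" using con_mono[OF ext_mono[OF S(2)]] by blast
  qed
qed

lemma t_op_con: "submod D N \<Longrightarrow> N \<noteq> {0} \<Longrightarrow> t_op R (con N) = con N"
  using con_ext[OF submod_con] con_eq_zero_iff ext_con by metis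

lemma dom_ideal_con: "dom_ideal D N \<Longrightarrow> dom_ideal R (con N)"
  unfolding dom_ideal_iff_submod using submod_con con_mono con_ring by blast

lemma dom_ideal_ext: "A \<subseteq> R \<Longrightarrow> dom_ideal D (ext A)"
  unfolding dom_ideal_iff_submod
  using submod_ext ext_subset_iff[OF submod_subring[OF ring_D]] con_ring by simp

lemma con_ideal_eq_ring_iff: "submod D N \<Longrightarrow> con N = R \<longleftrightarrow> N = D"
  using con_inject[OF _ submod_subring[OF ring_D]] con_ring by simp

lemma ext_nonzero: "submod R A \<Longrightarrow> A \<noteq> {0} \<Longrightarrow> ext A \<noteq> {0}"
  using con_ext_superset[of A] con_eq_zero_iff[OF submod_ext] submodD(1)[of R A] by blast

text \<open>For the harder inclusion one factor is treated at a time: with the other factor fixed,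
  the admissible elements form a \<open>D\<close>-submodule, so it is enough to test
  constants.\<close>

lemma mod_prod_ext: "mod_prod (ext A) (ext B) = ext (mod_prod A B)"
proof
  have sm: "submod D (mod_prod (ext A) (ext B))" by (rule submod_mod_prod[OF submod_ext])
  have "mod_prod A B \<subseteq> con (mod_prod (ext A) (ext B))"
  proof (rule mod_prod_least[OF submod_con[OF sm]])
    fix a b assume "a \<in> A" "b \<in> B"
    then have "\<iota> a \<in> ext A" "\<iota> b \<in> ext B" using con_ext_superset unfolding con_def by auto
    then show "a * b \<in> con (mod_prod (ext A) (ext B))" by (simp add: con_def hom_mult mod_prodI)
  qed
  then show "ext (mod_prod A B) \<subseteq> mod_prod (ext A) (ext B)" using ext_subset_iff[OF sm] by blast
  show "mod_prod (ext A) (ext B) \<subseteq> ext (mod_prod A B)"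
  proof (rule mod_prod_least[OF submod_ext])
    fix x y assume xy: "x \<in> ext A" "y \<in> ext B"
    have sub: "submod D {u. z * u \<in> ext (mod_prod A B)}" for z
      unfolding submod_def using submodD[OF submod_ext[of "mod_prod A B"]]
      by (auto simp: ring_distribs mult.left_commute)
    have "\<iota> a * y \<in> ext (mod_prod A B)" if a: "a \<in> A" for a
    proof -
      have "B \<subseteq> con {u. \<iota> a * u \<in> ext (mod_prod A B)}"
      proof
        fix b assume "b \<in> B"
        then have "a * b \<in> con (ext (mod_prod A B))"
          using mod_prodI[OF a] con_ext_superset[of "mod_prod A B"] by blast
        then show "b \<in> con {u. \<iota> a * u \<in> ext (mod_prod A B)}" by (simp add: con_def hom_mult)
      qed
      then have "ext B \<subseteq> {u. \<iota> a * u \<in> ext (mod_prod A B)}"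
        using ext_subset_iff[OF sub] by blast
      then show ?thesis using xy(2) by blast
    qed
    then have "A \<subseteq> con {u. y * u \<in> ext (mod_prod A B)}"
      by (auto simp: con_def mult.commute)
    then have "ext A \<subseteq> {u. y * u \<in> ext (mod_prod A B)}"
      using ext_subset_iff[OF sub] by blast
    then show "x * y \<in> ext (mod_prod A B)" using xy(1) by (auto simp: mult.commute)
  qed
qed

text \<open>By \<open>ext_con\<close> it is enough to find the constants of the left-hand side, and
  for a constant multiplier the condition on \<open>ext A\<close> can be tested on
  \<open>A\<close>.\<close>

lemma colon_ext: "colon D (ext A) = ext (colon R A)"
proof -
  have "con (colon D (ext A)) = colon R A"
  proof -
    have "x \<in> con (colon D (ext A)) \<longleftrightarrow> x \<in> colon R A" for x
    proof -
      have s: "submod D {y. \<iota> x * y \<in> D}"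
        unfolding submod_def using is_subringD[OF ring_D]
        by (auto simp: ring_distribs mult.left_commute)
      have "x \<in> con (colon D (ext A)) \<longleftrightarrow> ext A \<subseteq> {y. \<iota> x * y \<in> D}"
        unfolding con_def colon_def by auto
      also have "\<dots> \<longleftrightarrow> A \<subseteq> con {y. \<iota> x * y \<in> D}"
        using ext_subset_iff[OF s] by simp
      also have "\<dots> \<longleftrightarrow> x \<in> colon R A"
        unfolding con_def colon_def by (auto simp: hom_mult[symmetric] hom_mem_ring_iff)
      finally show ?thesis .
    qed
    then show ?thesis by blast
  qed
  then show ?thesis using ext_con[OF submod_colon[OF ring_D]] by metis
qed

section \<open>Primes, radicals and localizations under contraction\<close>

lemma dom_prime_con:
  assumes "dom_prime D N"
  shows "dom_prime R (con N)"
proof -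
  note N = dom_primeD[OF assms]
  have "dom_ideal D N" "N \<noteq> D" using assms unfolding dom_prime_def by auto
  then have "dom_ideal R (con N)" "con N \<noteq> R" using dom_ideal_con con_ideal_eq_ring_iff[OF N(1)] by auto
  moreover have "a \<in> con N \<or> b \<in> con N" if "a \<in> R" "b \<in> R" "a * b \<in> con N" for a b
    using N(3)[of "\<iota> a" "\<iota> b"] that hom_mem_ring_iff unfolding con_def by (simp add: hom_mult)
  ultimately show ?thesis unfolding dom_prime_def by simp
qed

lemma t_ideal_con: "dom_ideal D N \<Longrightarrow> N \<noteq> {0} \<Longrightarrow> t_ideal R (con N)"
  using dom_ideal_con[of N] t_op_con[of N] con_eq_zero_iff[of N]
  unfolding t_ideal_def dom_ideal_iff_submod by blast

lemma t_prime_con: "dom_prime D N \<Longrightarrow> N \<noteq> {0} \<Longrightarrow> t_prime R (con N)"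
  using dom_prime_con[of N] t_ideal_con[of N] unfolding t_prime_def by (simp add: dom_prime_def)

lemma con_ext_t_ideal: "t_ideal R A \<Longrightarrow> con (ext A) = A"
  using con_ext[of A] unfolding t_ideal_def dom_ideal_iff_submod by simp

text \<open>If \<open>x * y\<close> lies in \<open>ext P\<close>, any product of an element of the
  content of \<open>x\<close> with one of the content of \<open>y\<close> is a
  \<open>D\<close>-multiple of \<open>x * y\<close>, hence a constant of \<open>ext P\<close>, that
  is, in \<open>P\<close>. Primality of \<open>P\<close> then forces one whole content into
  \<open>P\<close>.\<close>

lemma dom_prime_ext:
  assumes "t_prime R P"
  shows "dom_prime D (ext P)" "ext P \<noteq> {0}" "con (ext P) = P"
proof -
  have P: "dom_prime R P" "t_ideal R P" using assms unfolding t_prime_def by auto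
  show c: "con (ext P) = P" by (rule con_ext_t_ideal[OF P(2)])
  have PR: "P \<subseteq> R" "submod R P" using dom_primeD[OF P(1)] by auto
  show "ext P \<noteq> {0}" using ext_nonzero[OF PR(2)] P(2) unfolding t_ideal_def by blast
  have "x \<in> ext P \<or> y \<in> ext P" if xy: "x \<in> D" "y \<in> D" "x * y \<in> ext P" for x y
  proof -
    obtain S where S: "finite S" "\<forall>N. submod D N \<longrightarrow> (x \<in> N \<longleftrightarrow> S \<subseteq> con N)" "\<forall>s\<in>S. \<exists>d\<in>D. \<iota> s = d * x"
      by (rule content[of x])
    obtain S' where S': "finite S'" "\<forall>N. submod D N \<longrightarrow> (y \<in> N \<longleftrightarrow> S' \<subseteq> con N)" "\<forall>s\<in>S'. \<exists>d\<in>D. \<iota> s = d * y"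
      by (rule content[of y])
    have SR: "S \<subseteq> R" "S' \<subseteq> R"
      using S(2)[rule_format, OF submod_subring[OF ring_D]] S'(2)[rule_format, OF submod_subring[OF ring_D]] xy con_ring by auto
    have "s \<in> P \<or> s' \<in> P" if ss: "s \<in> S" "s' \<in> S'" for s s'
    proof -
      obtain d d' where d: "d \<in> D" "\<iota> s = d * x" "d' \<in> D" "\<iota> s' = d' * y" using S(3) S'(3) ss by blast
      have "\<iota> (s * s') = (d * d') * (x * y)" using d by (simp add: hom_mult)
      also have "\<dots> \<in> ext P" using submodD(3)[OF submod_ext] is_subringD(5)[OF ring_D] d xy(3) by blast
      finally have "s * s' \<in> P" using c unfolding con_def by blast
      then show ?thesis using dom_primeD(3)[OF P(1)] SR ss by blast
    qed
    then have "S \<subseteq> P \<or> S' \<subseteq> P" by blast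
    then show ?thesis using S(2)[rule_format, OF submod_ext[of P]] S'(2)[rule_format, OF submod_ext[of P]] c by simp
  qed
  moreover have "dom_ideal D (ext P)" by (rule dom_ideal_ext[OF PR(1)])
  moreover have "ext P \<noteq> D"
    using con_ideal_eq_ring_iff[OF submod_ext[of P]] c P(1) unfolding dom_prime_def by simp
  ultimately show "dom_prime D (ext P)" unfolding dom_prime_def by blast
qed

text \<open>The radical property descends by restricting to constants. It ascends through contents:
  \<open>\<iota> s = d * x\<close> turns \<open>x ^ n \<in> N\<close> into
  \<open>s ^ n \<in> con N\<close>.\<close>

lemma is_radical_con_iff:
  assumes N: "submod D N" "N \<subseteq> D"
  shows "is_radical R (con N) \<longleftrightarrow> is_radical D N"
proof
  have R: "con N \<subseteq> R" using con_mono[OF N(2)] con_ring by simp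
  show "is_radical R (con N)" if r: "is_radical D N"
  proof -
    have "x \<in> con N" if "x \<in> R" "x ^ n \<in> con N" for x n
    proof -
      have "\<iota> x \<in> D" "\<iota> x ^ n \<in> N" using that by (auto simp: hom_mem_ring_iff con_def hom_power)
      then have "\<iota> x \<in> N" using r unfolding is_radical_def radical_def by blast
      then show ?thesis unfolding con_def by simp
    qed
    then have "radical R (con N) \<subseteq> con N" unfolding radical_def by blast
    moreover have "con N \<subseteq> radical R (con N)"
      using R unfolding radical_def by (auto intro!: exI[of _ "1::nat"])
    ultimately show ?thesis unfolding is_radical_def by blast
  qed
  show "is_radical D N" if r: "is_radical R (con N)"
  proof -
    have "x \<in> N" if x: "x \<in> D" "x ^ n \<in> N" for x and n :: nat
    proof -
      obtain S where S: "finite S" "\<forall>N. submod D N \<longrightarrow> (x \<in> N \<longleftrightarrow> S \<subseteq> con N)" "\<forall>s\<in>S. \<exists>d\<in>D. \<iota> s = d * x"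
        by (rule content[of x])
      have SR: "S \<subseteq> R" using S(2)[rule_format, OF submod_subring[OF ring_D]] x con_ring by auto
      have "s \<in> con N" if s: "s \<in> S" for s
      proof -
        obtain d where d: "d \<in> D" "\<iota> s = d * x" using S(3)[rule_format, OF s] by blast
        have "\<iota> (s ^ n) = d ^ n * x ^ n" using d by (simp add: hom_power power_mult_distrib)
        also have "\<dots> \<in> N" using submodD(3)[OF N(1) is_subringD(7)[OF ring_D d(1)] x(2)] .
        finally have "s ^ n \<in> con N" unfolding con_def by simp
        then show ?thesis using r s SR unfolding is_radical_def radical_def by blast
      qed
      then show ?thesis using S(2)[rule_format, OF N(1)] by blast
    qed
    then have "radical D N \<subseteq> N" unfolding radical_def by blast
    moreover have "N \<subseteq> radical D N"
      using N(2) unfolding radical_def by (auto intro!: exI[of _ "1::nat"])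
    ultimately show ?thesis unfolding is_radical_def by blast
  qed
qed

lemma con_loc:
  assumes N: "dom_prime D N"
  shows "con (loc D N) = loc R (con N)"
proof
  note pN = dom_primeD[OF N]
  have z: "0 \<in> con N" using submodD(1)[OF submod_con[OF pN(1)]] .
  show "loc R (con N) \<subseteq> con (loc D N)"
  proof
    fix x assume "x \<in> loc R (con N)"
    then obtain a s where as: "a \<in> R" "s \<in> R" "s \<notin> con N" "x = a / s" by (auto simp: loc_iff)
    have "s \<noteq> 0" using as(3) z by auto
    then have "\<iota> x = \<iota> a / \<iota> s" using as(4) hom_divide by simp
    moreover have "\<iota> a \<in> D" "\<iota> s \<in> D" "\<iota> s \<notin> N" using as hom_mem_ring_iff unfolding con_def by auto
    ultimately show "x \<in> con (loc D N)" unfolding con_def loc_iff by blast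
  qed
  show "con (loc D N) \<subseteq> loc R (con N)"
  proof
    fix x assume "x \<in> con (loc D N)"
    then obtain a s where as: "a \<in> D" "s \<in> D" "s \<notin> N" "\<iota> x = a / s" by (auto simp: loc_iff con_def)
    have "s \<noteq> 0" using as(3) submodD(1)[OF pN(1)] by auto
    then have xs: "\<iota> x * s = a" using as(4) by simp
    obtain S where S: "finite S" "\<forall>N. submod D N \<longrightarrow> (s \<in> N \<longleftrightarrow> S \<subseteq> con N)" "\<forall>t\<in>S. \<exists>d\<in>D. \<iota> t = d * s"
      by (rule content[of s])
    \<comment> \<open>The denominator \<open>s\<close> need not be constant. Some element of its
      content also avoids \<open>N\<close>; being a \<open>D\<close>-multiple of \<open>s\<close>,
      it serves as a constant denominator.\<close>
    obtain t where t: "t \<in> S" "t \<notin> con N" using S(2)[rule_format, OF pN(1)] as(3) by blast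
    have tR: "t \<in> R" using S(2)[rule_format, OF submod_subring[OF ring_D]] as(2) t(1) con_ring by auto
    have t0: "t \<noteq> 0" using t(2) z by auto
    obtain d where d: "d \<in> D" "\<iota> t = d * s" using S(3)[rule_format, OF t(1)] by blast
    have "\<iota> (x * t) = d * a" using xs d(2) by (simp add: hom_mult ac_simps)
    also have "\<dots> \<in> D" by (rule is_subringD(5)[OF ring_D d(1) as(1)])
    finally have "x * t \<in> R" by (simp add: hom_mem_ring_iff)
    moreover have "x = (x * t) / t" using t0 by simp
    ultimately show "x \<in> loc R (con N)" using tR t(2) unfolding loc_iff by blast
  qed
qed

text \<open>Contraction commutes with intersections and localizations, and is injective on
  \<open>D\<close>-submodules, among which are the intersections of localizations.\<close>

lemma Inter_loc_con_eq_iff: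
  assumes "\<And>N. N \<in> \<M> \<Longrightarrow> dom_prime D N" "\<And>N. N \<in> \<N> \<Longrightarrow> dom_prime D N"
  shows "(\<Inter>P\<in>con ` \<M>. loc R P) = (\<Inter>P\<in>con ` \<N>. loc R P) \<longleftrightarrow> (\<Inter>N\<in>\<M>. loc D N) = (\<Inter>N\<in>\<N>. loc D N)"
proof -
  have con: "(\<Inter>P\<in>con ` \<M>. loc R P) = con (\<Inter>N\<in>\<M>. loc D N)" if "\<And>N. N \<in> \<M> \<Longrightarrow> dom_prime D N" for \<M>
    unfolding image_image using con_loc[OF that] by (auto simp: con_def)
  have "submod D (\<Inter>N\<in>\<M>. loc D N)" if "\<And>N. N \<in> \<M> \<Longrightarrow> dom_prime D N" for \<M>
    using submod_loc[OF ring_D that] by (intro submod_Inter) auto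
  then show ?thesis using con con_inject assms by simp
qed

text \<open>The contents of \<open>x\<close> and \<open>y\<close> together generate the same module
  as \<open>x\<close> and \<open>y\<close>, and finitely many constants generate a principal module.
  Its generator \<open>z\<close> divides both elements and lies in \<open>D x + D y\<close>.\<close>

lemma bezout_D: "bezout D"
  unfolding bezout_def
proof (intro conjI allI)
  show "is_subring D" by (rule ring_D)
  fix x y
  obtain S where S: "finite S" "mod_prod D {x} = mod_prod D (\<iota> ` S)" using principal_has_content by blast
  obtain S' where S': "finite S'" "mod_prod D {y} = mod_prod D (\<iota> ` S')" using principal_has_content by blast
  obtain z where z: "mod_prod D (\<iota> ` (S \<union> S')) = mod_prod D {z}"
    using finitely_generated_principal[of "S \<union> S'"] S(1) S'(1) by blast
  have sub: "mod_prod D {x} \<subseteq> mod_prod D {z}" "mod_prod D {y} \<subseteq> mod_prod D {z}"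
    unfolding S(2) S'(2) z[symmetric] by (intro mod_prod_mono; blast)+
  then have "x \<in> mod_prod D {z}" "y \<in> mod_prod D {z}"
    using generated_superset[OF ring_D, of "{x}"] generated_superset[OF ring_D, of "{y}"] by auto
  then obtain a b where ab: "a \<in> D" "x = a * z" "b \<in> D" "y = b * z"
    unfolding generated_singleton[OF ring_D] by blast
  let ?J = "{c * x + d * y | c d. c \<in> D \<and> d \<in> D}"
  have J: "submod D ?J"
    unfolding submod_def
  proof (intro conjI ballI)
    show "0 \<in> ?J" using is_subringD(1)[OF ring_D] by force
    show "u + v \<in> ?J" if uv: "u \<in> ?J" "v \<in> ?J" for u v
    proof -
      obtain c d c' d' where h: "u = c * x + d * y" "v = c' * x + d' * y" "c \<in> D" "d \<in> D" "c' \<in> D" "d' \<in> D"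
        using uv by auto
      have "u + v = (c + c') * x + (d + d') * y" unfolding h(1,2) by (simp add: algebra_simps)
      then show ?thesis using h(3-6) is_subringD(3)[OF ring_D] by blast
    qed
    show "r * u \<in> ?J" if ru: "r \<in> D" "u \<in> ?J" for r u
    proof -
      obtain c d where h: "u = c * x + d * y" "c \<in> D" "d \<in> D" using ru(2) by auto
      have "r * u = (r * c) * x + (r * d) * y" unfolding h(1) by (simp add: algebra_simps)
      then show ?thesis using h(2,3) ru(1) is_subringD(5)[OF ring_D] by blast
    qed
  qed
  have "x \<in> ?J"
    using is_subringD(1,2)[OF ring_D] by (intro CollectI exI[of _ 1] exI[of _ 0]) simp
  moreover have "y \<in> ?J"
    using is_subringD(1,2)[OF ring_D] by (intro CollectI exI[of _ 0] exI[of _ 1]) simp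
  ultimately have "mod_prod D {x} \<subseteq> ?J" "mod_prod D {y} \<subseteq> ?J"
    using generated_subset_iff[OF ring_D J] by simp_all
  then have "\<iota> ` S \<subseteq> ?J" "\<iota> ` S' \<subseteq> ?J"
    unfolding S(2) S'(2) generated_subset_iff[OF ring_D J] by simp_all
  then have "\<iota> ` (S \<union> S') \<subseteq> ?J" unfolding image_Un by (rule Un_least)
  then have "mod_prod D {z} \<subseteq> ?J"
    unfolding z[symmetric] generated_subset_iff[OF ring_D J] .
  then have "z \<in> ?J" using generated_superset[OF ring_D, of "{z}"] by blast
  then obtain c d where "c \<in> D" "d \<in> D" "z = c * x + d * y" by (elim CollectE exE conjE)
  then show "\<exists>z a b c d. a \<in> D \<and> b \<in> D \<and> c \<in> D \<and> d \<in> D \<and> x = a * z \<and> y = b * z \<and> z = c * x + d * y"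
    using ab by (intro exI[of _ z] exI[of _ a] exI[of _ b] exI[of _ c] exI[of _ d] conjI)
qed

text \<open>The hypothesis \<open>R \<noteq> UNIV\<close> enters here: the denominator
  \<open>b\<close> of an element outside \<open>R\<close> gives a nonzero nonunit of
  \<open>D\<close>, so the zero ideal is not maximal.\<close>

lemma dom_maximal_nonzero:
  assumes "is_domain_of R" "R \<noteq> UNIV" and N: "dom_maximal D N"
  shows "N \<noteq> {0}"
proof
  assume N0: "N = {0}"
  obtain x where x: "x \<notin> R" using assms(2) by blast
  obtain a b where ab: "a \<in> R" "b \<in> R" "b \<noteq> 0" "x = a / b"
    using assms(1) unfolding is_domain_of_def by blast
  have J: "dom_ideal D (ext {b})" by (rule dom_ideal_ext) (use ab in simp)
  have b: "\<iota> b \<in> ext {b}" using con_ext_superset[of "{b}"] unfolding con_def by simp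
  have "ext {b} \<noteq> D"
  proof
    assume "ext {b} = D"
    then have "1 \<in> mod_prod D {\<iota> b}" using is_subringD(2)[OF ring_D] unfolding ext_def by simp
    then obtain d where d: "d \<in> D" "1 = d * \<iota> b" unfolding generated_singleton[OF ring_D] by blast
    have "\<iota> x = \<iota> a / \<iota> b" using ab(3,4) hom_divide by simp
    also have "\<dots> = \<iota> a * d" using d(2) by (auto simp: divide_eq_eq mult.assoc)
    finally have "\<iota> x = \<iota> a * d" .
    also have "\<dots> \<in> D" using is_subringD(5)[OF ring_D] d(1) ab(1) hom_mem_ring_iff by simp
    finally show False using x hom_mem_ring_iff by simp
  qed
  moreover have "N \<subseteq> ext {b}" using N0 submodD(1)[OF submod_ext] by simp
  ultimately have "ext {b} = N" using N J unfolding dom_maximal_def by simp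
  then show False using b N0 ab(3) hom_eq_zero_iff by simp
qed

text \<open>A proper t-ideal above \<open>con N\<close> extends to a proper ideal above
  \<open>N\<close>. Since t-ideals are nonzero by definition, \<open>N\<close> must be known to be
  nonzero.\<close>

lemma t_Max_con:
  assumes "is_domain_of R" "R \<noteq> UNIV" and N: "dom_maximal D N"
  shows "con N \<in> t_Max R"
proof -
  have id: "dom_ideal D N" "N \<noteq> D" using N unfolding dom_maximal_def by auto
  then have sN: "submod D N" by (simp add: dom_ideal_iff_submod)
  have "J = con N" if J: "t_ideal R J" "con N \<subseteq> J" "J \<noteq> R" for J
  proof -
    have c: "con (ext J) = J" by (rule con_ext_t_ideal[OF J(1)])
    have "J \<subseteq> R" using J(1) unfolding t_ideal_def dom_ideal_def by simp
    then have "dom_ideal D (ext J)" by (rule dom_ideal_ext)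
    moreover have "ext J \<noteq> D" using con_ideal_eq_ring_iff[OF submod_ext[of J]] c J(3) by simp
    moreover have "N \<subseteq> ext J" using con_subset_iff[OF sN submod_ext[of J]] c J(2) by simp
    ultimately have "ext J = N" using N unfolding dom_maximal_def by simp
    then show ?thesis using c by simp
  qed
  moreover have "t_ideal R (con N)" by (rule t_ideal_con[OF id(1) dom_maximal_nonzero[OF assms]])
  moreover have "con N \<noteq> R" using con_ideal_eq_ring_iff[OF sN] id(2) by simp
  ultimately show ?thesis unfolding t_Max_def by simp
qed

lemma dom_maximal_ext:
  assumes "M \<in> t_Max R"
  shows "dom_maximal D (ext M)" "con (ext M) = M"
proof -
  have M: "t_ideal R M" "M \<noteq> R" using assms unfolding t_Max_def by auto
  show c: "con (ext M) = M" by (rule con_ext_t_ideal[OF M(1)])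
  have sM: "M \<subseteq> R" "submod R M" "M \<noteq> {0}"
    using M(1) unfolding t_ideal_def dom_ideal_iff_submod by auto
  have "J = ext M" if J: "dom_ideal D J" "ext M \<subseteq> J" "J \<noteq> D" for J
  proof -
    have sJ: "submod D J" using J(1) by (simp add: dom_ideal_iff_submod)
    have "J \<noteq> {0}" using J(2) ext_nonzero[OF sM(2,3)] submodD(1)[OF submod_ext[of M]] by blast
    then have "t_ideal R (con J)" by (rule t_ideal_con[OF J(1)])
    moreover have "M \<subseteq> con J" using con_mono[OF J(2)] c by simp
    moreover have "con J \<noteq> R" using con_ideal_eq_ring_iff[OF sJ] J(3) by simp
    ultimately have "con J = M" using assms unfolding t_Max_def by simp
    then show ?thesis using ext_con[OF sJ] by simp
  qed
  moreover have "dom_ideal D (ext M)" by (rule dom_ideal_ext[OF sM(1)])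
  moreover have "ext M \<noteq> D" using con_ideal_eq_ring_iff[OF submod_ext[of M]] c M(2) by simp
  ultimately show "dom_maximal D (ext M)" unfolding dom_maximal_def by simp
qed

lemma con_image_inject:
  assumes "\<And>N. N \<in> \<M> \<Longrightarrow> submod D N" "\<And>N. N \<in> \<N> \<Longrightarrow> submod D N"
  shows "con ` \<M> = con ` \<N> \<longleftrightarrow> \<M> = \<N>"
proof -
  have "inj_on con (\<M> \<union> \<N>)"
    by (rule inj_onI) (use con_inject assms in auto)
  then show ?thesis by (rule inj_on_image_eq_iff) auto
qed

text \<open>Separates the empty family, whose intersection is the whole field, from all nonempty
  families of t-primes.\<close>

lemma Inter_loc_ne_UNIV:
  assumes "\<P> \<subseteq> {P. t_prime R P}" "\<P> \<noteq> {}"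
  shows "(\<Inter>P\<in>\<P>. loc R P) \<noteq> UNIV"
proof -
  obtain P where P: "P \<in> \<P>" using assms(2) by blast
  then have "dom_prime R P" "P \<noteq> {0}"
    using assms(1) unfolding t_prime_def t_ideal_def by auto
  then show ?thesis using loc_not_UNIV[OF ring_R] P by blast
qed

lemma t_Max_t_prime: "t_Max R \<subseteq> {P. t_prime R P}"
  using t_Max_prime[OF ring_R] t_Max_t_ideal unfolding t_prime_def by blast

section \<open>The three equivalences for content extensions\<close>

theorem t_sharp_iff_sharp:
  assumes "is_domain_of R" "R \<noteq> UNIV"
  shows "t_sharp R \<longleftrightarrow> sharp_domain D"
proof
  have prime: "dom_prime D N" if "dom_maximal D N" for N
    by (rule dom_maximal_prime[OF ring_D that])
  assume t: "t_sharp R"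
  show "sharp_domain D"
    unfolding sharp_domain_def
  proof (intro allI impI notI, elim conjE)
    fix \<M> \<N> assume h: "\<M> \<subseteq> {M. dom_maximal D M}" "\<N> \<subseteq> {M. dom_maximal D M}" "\<M> \<noteq> \<N>"
      and eq: "(\<Inter>M\<in>\<M>. loc D M) = (\<Inter>M\<in>\<N>. loc D M)"
    have p: "dom_prime D N" if "N \<in> \<M> \<or> N \<in> \<N>" for N
      using that h prime by auto
    have "con ` \<M> \<noteq> con ` \<N>"
      using con_image_inject[of \<M> \<N>] p dom_primeD(1) h(3) by metis
    moreover have "con ` \<M> \<subseteq> t_Max R" "con ` \<N> \<subseteq> t_Max R"
      using t_Max_con[OF assms] h by auto
    moreover have "(\<Inter>P\<in>con ` \<M>. loc R P) = (\<Inter>P\<in>con ` \<N>. loc R P)"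
      using Inter_loc_con_eq_iff[of \<M> \<N>] p eq by metis
    ultimately show False using t unfolding t_sharp_def by metis
  qed
next
  have prime: "dom_prime D N" if "dom_maximal D N" for N
    by (rule dom_maximal_prime[OF ring_D that])
  assume s: "sharp_domain D"
  show "t_sharp R"
    unfolding t_sharp_def
  proof (intro allI impI notI, elim conjE)
    fix \<M> \<N> assume h: "\<M> \<subseteq> t_Max R" "\<N> \<subseteq> t_Max R" "\<M> \<noteq> \<N>"
      and eq: "(\<Inter>M\<in>\<M>. loc R M) = (\<Inter>M\<in>\<N>. loc R M)"
    \<comment> \<open>\<open>sharp_domain\<close> compares nonempty families only, so the empty one
      has to be ruled out beforehand.\<close>
    have "\<M> = {} \<longleftrightarrow> \<N> = {}"
      using Inter_loc_ne_UNIV[of \<M>] Inter_loc_ne_UNIV[of \<N>] h(1,2) t_Max_t_prime eq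
      by (metis INF_empty subset_trans)
    then have ne: "\<M> \<noteq> {}" "\<N> \<noteq> {}" using h(3) by auto
    have ext: "con ` ext ` \<R> = \<R> \<and> ext ` \<R> \<subseteq> {M. dom_maximal D M}" if "\<R> \<subseteq> t_Max R" for \<R>
    proof -
      have "dom_maximal D (ext M)" "con (ext M) = M" if "M \<in> \<R>" for M
        using dom_maximal_ext[of M] that \<open>\<R> \<subseteq> t_Max R\<close> by auto
      then show ?thesis unfolding image_image by auto
    qed
    have p: "dom_prime D N" if "N \<in> ext ` \<M> \<or> N \<in> ext ` \<N>" for N
      using that ext[OF h(1)] ext[OF h(2)] prime by auto
    have "(\<Inter>N\<in>ext ` \<M>. loc D N) = (\<Inter>N\<in>ext ` \<N>. loc D N)"
      using Inter_loc_con_eq_iff[of "ext ` \<M>" "ext ` \<N>"] p eq ext[OF h(1)] ext[OF h(2)] by metis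
    moreover have "ext ` \<M> \<noteq> ext ` \<N>" using ext[OF h(1)] ext[OF h(2)] h(3) by metis
    moreover have "ext ` \<M> \<noteq> {}" "ext ` \<N> \<noteq> {}" using ne by auto
    moreover have "ext ` \<M> \<subseteq> {M. dom_maximal D M}" "ext ` \<N> \<subseteq> {M. dom_maximal D M}"
      using ext[OF h(1)] ext[OF h(2)] by auto
    ultimately show False using s unfolding sharp_domain_def by metis
  qed
qed

theorem t_sharp_sharp_iff_sharp_sharp: "t_sharp_sharp R \<longleftrightarrow> sharp_sharp_domain D"
proof
  assume t: "t_sharp_sharp R"
  show "sharp_sharp_domain D"
    unfolding sharp_sharp_domain_def sharp_domain_def
  proof (intro allI impI notI, elim conjE)
    fix T \<M> \<N> assume T: "overring D T"
      and h: "\<M> \<noteq> {}" "\<N> \<noteq> {}" "\<M> \<subseteq> {M. dom_maximal T M}" "\<N> \<subseteq> {M. dom_maximal T M}" "\<M> \<noteq> \<N>"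
      and eq: "(\<Inter>M\<in>\<M>. loc T M) = (\<Inter>M\<in>\<N>. loc T M)"
    have sT: "is_subring T" "D \<subseteq> T" using T unfolding overring_def by auto
    have max: "dom_maximal T M" if "M \<in> \<M> \<or> M \<in> \<N>" for M using that h by auto
    have prime: "dom_prime T M" if "M \<in> \<M> \<or> M \<in> \<N>" for M
      by (rule dom_maximal_prime[OF sT(1) max[OF that]])
    have restr: "dom_prime D (M \<inter> D)" if "M \<in> \<M> \<or> M \<in> \<N>" for M
      by (rule dom_prime_restrict[OF prime[OF that] ring_D sT(2)])
    have loc: "loc T M = loc D (M \<inter> D)" if "M \<in> \<M> \<or> M \<in> \<N>" for M
      by (rule bezout_loc_overring[OF bezout_D T prime[OF that]])
    \<comment> \<open>The contraction to \<open>D\<close> determines the localization of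
      \<open>T\<close>, which in turn determines the maximal ideal; inclusion of contractions thus
      gives inclusion of maximal ideals.\<close>
    have incomp: "M = M'" if M: "M \<in> \<M> \<or> M \<in> \<N>" "M' \<in> \<M> \<or> M' \<in> \<N>" and sub: "M \<inter> D \<subseteq> M' \<inter> D" for M M'
    proof -
      have "loc T M' \<subseteq> loc T M" unfolding loc[OF M(1)] loc[OF M(2)] by (rule loc_antimono[OF sub])
      then have "M \<subseteq> M'" by (rule loc_subset_imp[OF sT(1) prime[OF M(1)] prime[OF M(2)]])
      then show ?thesis using max[OF M(1)] max[OF M(2)] unfolding dom_maximal_def by simp
    qed
    \<comment> \<open>A zero contraction lies below all other contractions, so \<open>M\<close>
      would be the only member of either family and the two families would agree.\<close>
    have nz: "M \<inter> D \<noteq> {0}" if M: "M \<in> \<M> \<or> M \<in> \<N>" for M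
    proof
      assume M0: "M \<inter> D = {0}"
      have "M' = M" if M': "M' \<in> \<M> \<or> M' \<in> \<N>" for M'
      proof -
        have "M \<inter> D \<subseteq> M' \<inter> D"
          using M0 submodD(1)[OF dom_primeD(1)[OF restr[OF M']]] by simp
        then show ?thesis using incomp[OF M M'] by simp
      qed
      then have "\<M> = {M}" "\<N> = {M}" using h(1,2) by auto
      then show False using h(5) by simp
    qed
    define F where "F = (\<lambda>M. con (M \<inter> D))"
    have F: "F ` \<R> = con ` (\<lambda>M. M \<inter> D) ` \<R>" for \<R> unfolding F_def image_image by simp
    have tp: "t_prime R (F M)" if "M \<in> \<M> \<or> M \<in> \<N>" for M
      unfolding F_def by (rule t_prime_con[OF restr[OF that] nz[OF that]])
    have F_sub: "M = M'" if M: "M \<in> \<M> \<or> M \<in> \<N>" "M' \<in> \<M> \<or> M' \<in> \<N>" and "F M \<subseteq> F M'" for M M'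
    proof -
      have "M \<inter> D \<subseteq> M' \<inter> D"
        using \<open>F M \<subseteq> F M'\<close> con_subset_iff[OF dom_primeD(1)[OF restr[OF M(1)]] dom_primeD(1)[OF restr[OF M(2)]]]
        unfolding F_def by simp
      then show ?thesis by (rule incomp[OF M])
    qed
    have "inj_on F (\<M> \<union> \<N>)" by (rule inj_onI) (use F_sub in auto)
    then have "F ` \<M> = F ` \<N> \<longleftrightarrow> \<M> = \<N>" by (rule inj_on_image_eq_iff) auto
    then have "F ` \<M> \<noteq> F ` \<N>" using h(5) by simp
    moreover have "pairwise_incomparable (F ` \<M>)" "pairwise_incomparable (F ` \<N>)"
      unfolding pairwise_incomparable_def using F_sub by auto
    moreover have "F ` \<M> \<subseteq> {P. t_prime R P}" "F ` \<N> \<subseteq> {P. t_prime R P}"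
      using tp by auto
    moreover have "(\<Inter>P\<in>F ` \<M>. loc R P) = (\<Inter>P\<in>F ` \<N>. loc R P)"
      unfolding F
    proof (subst Inter_loc_con_eq_iff)
      show "(\<Inter>N\<in>(\<lambda>M. M \<inter> D) ` \<M>. loc D N) = (\<Inter>N\<in>(\<lambda>M. M \<inter> D) ` \<N>. loc D N)"
        using eq loc unfolding image_image by simp
    qed (use restr in auto)
    ultimately show False using t unfolding t_sharp_sharp_def by metis
  qed
next
  assume s: "sharp_sharp_domain D"
  show "t_sharp_sharp R"
    unfolding t_sharp_sharp_def
  proof (intro allI impI notI, elim conjE)
    fix \<P> \<Q> assume h: "\<P> \<subseteq> {P. t_prime R P}" "\<Q> \<subseteq> {P. t_prime R P}"
      "pairwise_incomparable \<P>" "pairwise_incomparable \<Q>" "\<P> \<noteq> \<Q>"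
      and eq: "(\<Inter>P\<in>\<P>. loc R P) = (\<Inter>P\<in>\<Q>. loc R P)"
    have "\<P> = {} \<longleftrightarrow> \<Q> = {}"
      using Inter_loc_ne_UNIV[of \<P>] Inter_loc_ne_UNIV[of \<Q>] h(1,2) eq by (metis INF_empty)
    then have ne: "ext ` \<P> \<noteq> {}" "ext ` \<Q> \<noteq> {}" using h(5) by auto
    have ext: "con ` ext ` \<R> = \<R> \<and> (\<forall>N\<in>ext ` \<R>. dom_prime D N) \<and> pairwise_incomparable (ext ` \<R>)"
      if R: "\<R> \<subseteq> {P. t_prime R P}" "pairwise_incomparable \<R>" for \<R>
    proof -
      have e: "dom_prime D (ext P)" "con (ext P) = P" if "P \<in> \<R>" for P
        using dom_prime_ext[of P] that R(1) by auto
      have "P = Q" if "P \<in> \<R>" "Q \<in> \<R>" "ext P \<subseteq> ext Q" for P Q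
        using con_mono[OF that(3)] e(2) that R(2) unfolding pairwise_incomparable_def by simp
      then have "pairwise_incomparable (ext ` \<R>)" unfolding pairwise_incomparable_def by auto
      then show ?thesis using e unfolding image_image by auto
    qed
    note eP = ext[OF h(1,3)] and eQ = ext[OF h(2,4)]
    let ?T = "\<Inter>N\<in>ext ` \<P>. loc D N"
    have p: "dom_prime D N" if "N \<in> ext ` \<P> \<or> N \<in> ext ` \<Q>" for N
      using that eP eQ by auto
    have T: "(\<Inter>N\<in>ext ` \<Q>. loc D N) = ?T"
      using Inter_loc_con_eq_iff[of "ext ` \<P>" "ext ` \<Q>"] p eq eP eQ by metis
    have "is_subring ?T"
      unfolding is_subring_def
      using is_subringD[OF is_subring_loc[OF ring_D]] p by (intro conjI ballI) auto
    moreover have "D \<subseteq> ?T" using loc_superset[OF _ ring_D] p by blast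
    ultimately have "sharp_domain ?T"
      using s unfolding sharp_sharp_domain_def overring_def by simp
    then have "ext ` \<P> = ext ` \<Q>"
      using eP eQ ne
      by (intro bezout_sharp_Inter_loc_eq_imp_eq[OF bezout_D _ _ _ _ _ _ refl T]) auto
    then show False using eP eQ h(5) by metis
  qed
qed

text \<open>The product of \<open>ext I\<close> with its inverse is the extension of
  \<open>I (R : I)\<close>, whose contraction is the t-closure of that product. Being the whole ring
  and being radical are both preserved, and every nonzero ideal of \<open>D\<close> is the extension
  of its contraction.\<close>

theorem tRTP_iff_RTP: "tRTP_domain R \<longleftrightarrow> RTP_domain D"
proof -
  have key: "(mod_prod (ext I) (colon D (ext I)) = D \<or> is_radical D (mod_prod (ext I) (colon D (ext I)))) \<longleftrightarrow>
      (t_op R (mod_prod I (colon R I)) = R \<or> is_radical R (t_op R (mod_prod I (colon R I))))"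
    if I: "dom_ideal R I" "I \<noteq> {0}" for I
  proof -
    let ?J = "mod_prod I (colon R I)"
    have sI: "submod R I" "I \<subseteq> R" using I(1) by (auto simp: dom_ideal_iff_submod)
    have sJ: "submod R ?J" by (rule submod_mod_prod[OF sI(1)])
    \<comment> \<open>This gives \<open>I \<subseteq> ?J\<close>, hence the nonzero product that
      \<open>con_ext\<close> requires.\<close>
    have one: "1 \<in> colon R I" using sI(2) unfolding colon_def by auto
    obtain a where "a \<in> I" "a \<noteq> 0" using I(2) submodD(1)[OF sI(1)] by blast
    then have "a * 1 \<in> ?J" "a * 1 \<noteq> 0" using one by (auto intro: mod_prodI[of _ _ 1, simplified])
    then have "?J \<noteq> {0}" by blast
    then have c: "con (ext ?J) = t_op R ?J" by (rule con_ext[OF sJ])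
    have "?J \<subseteq> R"
      by (rule mod_prod_least[OF submod_subring[OF ring_R]]) (auto simp: colon_def mult.commute)
    then have "ext ?J \<subseteq> D" using dom_ideal_ext unfolding dom_ideal_def by blast
    then show ?thesis
      unfolding colon_ext mod_prod_ext c[symmetric]
      using is_radical_con_iff[OF submod_ext] con_ideal_eq_ring_iff[OF submod_ext] by simp
  qed
  show ?thesis
  proof
    assume t: "tRTP_domain R"
    show "RTP_domain D"
      unfolding RTP_domain_def
    proof (intro allI impI, elim conjE)
      fix N assume N: "dom_ideal D N" "N \<noteq> {0}"
      then have e: "ext (con N) = N" and nz: "con N \<noteq> {0}"
        using con_eq_zero_iff[of N] ext_con[of N] by (auto simp: dom_ideal_iff_submod)
      show "mod_prod N (colon D N) = D \<or> is_radical D (mod_prod N (colon D N))"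
        using key[OF dom_ideal_con[OF N(1)] nz] t dom_ideal_con[OF N(1)] nz
        unfolding e tRTP_domain_def by simp
    qed
  next
    assume r: "RTP_domain D"
    show "tRTP_domain R"
      unfolding tRTP_domain_def
    proof (intro allI impI, elim conjE)
      fix I assume I: "dom_ideal R I" "I \<noteq> {0}"
      then have sI: "submod R I" "I \<subseteq> R" by (auto simp: dom_ideal_iff_submod)
      show "t_op R (mod_prod I (colon R I)) = R \<or> is_radical R (t_op R (mod_prod I (colon R I)))"
        using key[OF I] r dom_ideal_ext[OF sI(2)] ext_nonzero[OF sI(1) I(2)]
        unfolding RTP_domain_def by simp
    qed
  qed
qed

end

section \<open>Gauss' lemma at a valuation localization\<close>

lemma loc_common_denominator:
  assumes D: "is_subring D" and P: "dom_prime D P" and S: "finite S" "S \<subseteq> loc D P"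
  obtains t where "t \<in> D" "t \<notin> P" "\<forall>s\<in>S. t * s \<in> D"
proof -
  have "\<exists>t. t \<in> D \<and> t \<notin> P \<and> (\<forall>s\<in>S. t * s \<in> D)"
    using S
  proof (induction S rule: finite_induct)
    case empty
    then show ?case using is_subringD(2)[OF D] dom_primeD(4)[OF P] by blast
  next
    case (insert x S)
    then obtain t where t: "t \<in> D" "t \<notin> P" "\<forall>s\<in>S. t * s \<in> D" by auto
    obtain a e where ae: "a \<in> D" "e \<in> D" "e \<notin> P" "x = a / e" using insert.prems by (auto simp: loc_iff)
    have "e \<noteq> 0" using ae(3) submodD(1)[OF dom_primeD(1)[OF P]] by auto
    then have "e * t * x = t * a" using ae(4) by simp
    then have "e * t * x \<in> D" using is_subringD(5)[OF D t(1) ae(1)] by metis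
    moreover have "e * t * s \<in> D" if "s \<in> S" for s
      using is_subringD(5)[OF D ae(2), of "t * s"] t(3) that by (simp add: mult.assoc)
    moreover have "e * t \<in> D" "e * t \<notin> P"
      using is_subringD(5)[OF D ae(2) t(1)] dom_primeD(3)[OF P ae(2) t(1)] ae(3) t(2) by auto
    ultimately show ?case by (intro exI[of _ "e * t"]) auto
  qed
  then show ?thesis using that by (elim exE conjE)
qed

lemma inverse_in_loc:
  assumes "x \<in> loc D P" "x \<notin> max_of_loc D P"
  shows "inverse x \<in> loc D P"
proof -
  obtain a s where as: "a \<in> D" "s \<in> D" "s \<notin> P" "x = a / s" using assms(1) by (auto simp: loc_iff)
  then have "a \<notin> P" using assms(2) unfolding max_of_loc_def by blast
  then show ?thesis using as unfolding loc_iff by (metis inverse_divide)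
qed

text \<open>Divisibility in a valuation ring is total, so a finite set has an element of minimal
  value; it can be chosen nonzero as soon as the set is not contained in zero.\<close>

lemma valuation_dominating_element:
  assumes V: "is_subring V" "valuation_dom V" and S: "finite S" "\<not> S \<subseteq> {0}"
  obtains a where "a \<in> S" "a \<noteq> 0" "\<forall>s\<in>S. s / a \<in> V"
proof -
  have "\<exists>a\<in>S. a \<noteq> 0 \<and> (\<forall>s\<in>S. s / a \<in> V)"
    using S
  proof (induction S rule: finite_induct)
    case (insert x S)
    show ?case
    proof (cases "S \<subseteq> {0}")
      case True
      then have x: "x \<noteq> 0" using insert.prems by blast
      have "s / x \<in> V" if "s \<in> insert x S" for s
        using that True x is_subringD(1,2)[OF V(1)] by auto
      then show ?thesis using x by blast
    next
      case False
      then obtain a where a: "a \<in> S" "a \<noteq> 0" "\<forall>s\<in>S. s / a \<in> V" using insert.IH by blast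
      show ?thesis
      proof (cases "x / a \<in> V")
        case True
        then show ?thesis using a by blast
      next
        case xa: False
        then have x: "x \<noteq> 0" using is_subringD(1)[OF V(1)] by auto
        have ax: "a / x \<in> V" using V(2) xa unfolding valuation_dom_def by (metis inverse_divide)
        have "s / x \<in> V" if "s \<in> insert x S" for s
        proof (cases "s = x")
          case True
          then show ?thesis using x is_subringD(2)[OF V(1)] by simp
        next
          case False
          then have "s / a * (a / x) \<in> V" using that a(3) ax is_subringD(5)[OF V(1)] by blast
          then show ?thesis using a(2) by simp
        qed
        then show ?thesis using x by blast
      qed
    qed
  qed simp
  then show ?thesis using that by (elim bexE conjE)
qed

lemma finite_range_coeff: "finite (range (coeff p))"
  by (simp add: range_coeff)

lemma range_coeff_subset_zero_iff: "range (coeff p) \<subseteq> {0} \<longleftrightarrow> p = 0"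
  by (auto simp: poly_eq_iff)

text \<open>Choose the least index of a coefficient of minimal value. An earlier coefficient whose
  quotient by it were a unit would also have minimal value.\<close>

lemma first_dominating_coeff:
  assumes R: "is_subring R" and P: "dom_prime R P" and V: "valuation_dom (loc R P)" and "f \<noteq> 0"
  obtains i where "coeff f i \<noteq> 0" "\<forall>j. coeff f j / coeff f i \<in> loc R P"
    "\<forall>j<i. coeff f j / coeff f i \<in> max_of_loc R P"
proof -
  let ?V = "loc R P"
  note sV = is_subring_loc[OF R P]
  let ?dom = "\<lambda>i. coeff f i \<noteq> 0 \<and> (\<forall>j. coeff f j / coeff f i \<in> ?V)"
  obtain a where a: "a \<in> range (coeff f)" "a \<noteq> 0" "\<forall>s\<in>range (coeff f). s / a \<in> ?V"
    using valuation_dominating_element[OF sV V finite_range_coeff] range_coeff_subset_zero_iff \<open>f \<noteq> 0\<close> by metis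
  then obtain i0 where "a = coeff f i0" by blast
  then have "?dom i0" using a by simp
  then have dom: "?dom (Least ?dom)" by (rule LeastI)
  define i where "i = Least ?dom"
  have i: "coeff f i \<noteq> 0" "\<And>j. coeff f j / coeff f i \<in> ?V" using dom unfolding i_def by blast+
  have "coeff f j / coeff f i \<in> max_of_loc R P" if j: "j < i" for j
  proof (rule ccontr)
    assume n: "coeff f j / coeff f i \<notin> max_of_loc R P"
    then have "coeff f j \<noteq> 0"
      using submodD(1)[OF dom_primeD(1)[OF dom_prime_max_of_loc[OF R P]]] by auto
    have inv: "coeff f i / coeff f j \<in> ?V"
      using inverse_in_loc[OF i(2) n] by simp
    have "coeff f k / coeff f j \<in> ?V" for k
      using is_subringD(5)[OF sV i(2)[of k] inv] i(1) by simp
    then have "?dom j" using \<open>coeff f j \<noteq> 0\<close> by simp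
    then have "i \<le> j" unfolding i_def by (rule Least_le)
    then show False using j by simp
  qed
  then show ?thesis using that i by blast
qed

text \<open>Divide \<open>f\<close> and \<open>h\<close> by their first coefficients of minimal
  value, at \<open>i\<close> and \<open>k\<close>. In the coefficient of the product at
  \<open>i + k\<close>, every term but one has a factor of index below \<open>i\<close> or below
  \<open>k\<close>, so this coefficient is \<open>1\<close> modulo the maximal ideal. Only the
  product of two coefficients is assumed to be in \<open>R\<close>, since the polynomials have
  coefficients in the field.\<close>

lemma gauss_lemma:
  assumes R: "is_subring R" and P: "dom_prime R P" and V: "valuation_dom (loc R P)"
    and fh: "coeff f a * coeff h b \<in> R" "coeff f a * coeff h b \<notin> P"
  obtains n where "coeff (f * h) n \<notin> P"
proof -
  let ?V = "loc R P" and ?m = "max_of_loc R P"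
  note sV = is_subringD[OF is_subring_loc[OF R P]]
  have pm: "dom_prime ?V ?m" by (rule dom_prime_max_of_loc[OF R P])
  note m = submodD[OF dom_primeD(1)[OF pm]]
  have "f \<noteq> 0" "h \<noteq> 0" using fh(2) submodD(1)[OF dom_primeD(1)[OF P]] by auto
  obtain i where i: "coeff f i \<noteq> 0" "\<forall>j. coeff f j / coeff f i \<in> ?V" "\<forall>j<i. coeff f j / coeff f i \<in> ?m"
    by (rule first_dominating_coeff[OF R P V \<open>f \<noteq> 0\<close>])
  obtain k where k: "coeff h k \<noteq> 0" "\<forall>j. coeff h j / coeff h k \<in> ?V" "\<forall>j<k. coeff h j / coeff h k \<in> ?m"
    by (rule first_dominating_coeff[OF R P V \<open>h \<noteq> 0\<close>])
  let ?t = "\<lambda>j. coeff f j / coeff f i * (coeff h (i + k - j) / coeff h k)"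
  let ?c = "coeff (f * h) (i + k)"
  let ?u = "?c / (coeff f i * coeff h k)"
  have "?u = (\<Sum>j\<le>i + k. ?t j)"
    by (simp add: coeff_mult sum_divide_distrib)
  also have "\<dots> = ?t i + (\<Sum>j\<in>{..i + k} - {i}. ?t j)"
    by (rule sum.remove) auto
  also have "?t i = 1" using i(1) k(1) by simp
  finally have u: "?u = 1 + (\<Sum>j\<in>{..i + k} - {i}. ?t j)" .
  have tm: "(\<Sum>j\<in>{..i + k} - {i}. ?t j) \<in> ?m"
  proof (rule submod_sum[OF dom_primeD(1)[OF pm]])
    fix j assume j: "j \<in> {..i + k} - {i}"
    show "?t j \<in> ?m"
    proof (cases "j < i")
      case True
      then show ?thesis using m(3)[of "coeff h (i + k - j) / coeff h k" "coeff f j / coeff f i"] i(3) k(2)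
        by (simp add: mult.commute)
    next
      case False
      then have "i + k - j < k" using j by auto
      then show ?thesis using m(3) i(2) k(3) by blast
    qed
  qed
  have uV: "?u \<in> ?V" unfolding u using sV(2,3) tm dom_primeD(2)[OF pm] by blast
  have "?u \<notin> ?m"
  proof
    assume "?u \<in> ?m"
    moreover have "- (\<Sum>j\<in>{..i + k} - {i}. ?t j) \<in> ?m"
      using m(3)[OF sV(6)[OF sV(2)] tm] by simp
    ultimately have "?u + - (\<Sum>j\<in>{..i + k} - {i}. ?t j) \<in> ?m" by (rule m(2))
    then have "1 \<in> ?m" unfolding u by simp
    then show False using dom_primeD(4)[OF pm] by blast
  qed
  then have inv: "inverse ?u \<in> ?V" by (rule inverse_in_loc[OF uV])
  have u0: "?u \<noteq> 0" using \<open>?u \<notin> ?m\<close> m(1) by metis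
  have "?c \<notin> P"
  proof
    assume "?c \<in> P"
    then have c: "?c \<in> ?m" using max_of_loc_restrict[OF R P] by blast
    \<comment> \<open>By minimality of the values at \<open>i\<close> and \<open>k\<close>, the
      given product is a multiple of \<open>?c\<close> over the valuation ring; with
      \<open>?c\<close> it would lie in the maximal ideal and, being in \<open>R\<close>, in
      \<open>P\<close>.\<close>
    have "coeff f a * coeff h b = (coeff f a / coeff f i * (coeff h b / coeff h k) * inverse ?u) * ?c"
      using i(1) k(1) u0 by (simp add: field_simps)
    also have "\<dots> \<in> ?m" by (intro m(3)[OF _ c] sV(5) inv i(2)[rule_format] k(2)[rule_format])
    finally show False using fh max_of_loc_restrict[OF R P] by blast
  qed
  then show ?thesis by (rule that)
qed

section \<open>The t-Nagata ring of a PvMD\<close>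

text \<open>Zero always occurs among the coefficients, hence \<open>insert 0 S\<close>;
  \<open>generated_insert_zero\<close> removes it again.\<close>

lemma poly_with_coeffs:
  assumes "finite S"
  obtains p :: "'a::zero poly" where "range (coeff p) = insert 0 S"
proof -
  obtain xs where "set xs = S" using finite_list[OF assms] by blast
  then have "range (coeff (Poly xs)) = insert 0 S" by (simp add: coeff_Poly_eq)
  then show ?thesis by (rule that)
qed

text \<open>Extracts from a t-invertibility relation finitely many elements of the inverse, which
  can then be made the coefficients of one polynomial.\<close>

lemma mod_prod_finite_left:
  assumes "finite F" "F \<subseteq> mod_prod A S"
  obtains B where "finite B" "B \<subseteq> A" "F \<subseteq> mod_prod B S"
proof -
  have "\<exists>B. finite B \<and> B \<subseteq> A \<and> F \<subseteq> mod_prod B S"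
    using assms
  proof (induction F rule: finite_induct)
    case empty
    then show ?case by (intro exI[of _ "{}"]) auto
  next
    case (insert x F)
    then obtain B where B: "finite B" "B \<subseteq> A" "F \<subseteq> mod_prod B S" by auto
    obtain n f g where x: "\<forall>i<n. f i \<in> A \<and> g i \<in> S" "x = (\<Sum>i<(n::nat). f i * g i)"
      using insert.prems unfolding mod_prod_def by auto
    let ?B = "B \<union> f ` {..<n}"
    have "x \<in> mod_prod ?B S"
      unfolding mod_prod_def using x by (intro CollectI exI[of _ n] exI[of _ f] exI[of _ g]) auto
    moreover have "F \<subseteq> mod_prod ?B S" using B(3) mod_prod_mono[of B ?B S S] by blast
    moreover have "finite ?B" "?B \<subseteq> A" using B(1,2) x(1) by auto
    ultimately show ?case by (intro exI[of _ ?B]) auto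
  qed
  then show ?thesis using that by (elim exE conjE)
qed

section \<open>The multiplicative set \<open>N_t\<close>\<close>

lemma poly_ring_coeff: "f \<in> poly_ring R \<Longrightarrow> coeff f i \<in> R"
  unfolding poly_ring_def by simp

lemma poly_ring_mult:
  assumes "is_subring R" "\<And>i j. coeff f i * coeff h j \<in> R"
  shows "f * h \<in> poly_ring R"
proof -
  have "coeff (f * h) n \<in> R" for n
    unfolding coeff_mult by (intro submod_sum[OF submod_subring[OF assms(1)]] assms(2))
  then show ?thesis unfolding poly_ring_def by blast
qed

text \<open>The zero module has no nonzero finitely generated submodule, so its t-closure in the
  sense of \<open>t_op\<close> is empty.\<close>

lemma zero_notin_N_t:
  assumes "is_subring R"
  shows "0 \<notin> N_t R"
proof
  assume "0 \<in> N_t R"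
  then have "t_op R (content_ideal R 0) = R" unfolding N_t_def by simp
  then have "1 \<in> t_op R (content_ideal R 0)" using is_subringD(2)[OF assms] by simp
  moreover have "content_ideal R 0 = {0}"
    unfolding content_ideal_def using generated_eq_zero_iff[OF assms] by simp
  ultimately have "\<exists>J. fin_gen_nonzero R J \<and> J \<subseteq> {0}" unfolding t_op_def by auto
  then show False
    unfolding fin_gen_nonzero_def using mod_prod_zero by (metis empty_iff subset_singletonD)
qed

text \<open>A content ideal whose t-closure is proper lies in a maximal t-ideal, so
  \<open>N_t\<close> can be tested at the maximal t-ideals one by one, which is where Gauss' lemma
  is available.\<close>

lemma N_t_iff:
  assumes R: "is_subring R" and f: "f \<noteq> 0"
  shows "f \<in> N_t R \<longleftrightarrow> f \<in> poly_ring R \<and> (\<forall>M\<in>t_Max R. \<exists>i. coeff f i \<notin> M)"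
proof
  assume h: "f \<in> N_t R"
  then have c: "t_op R (content_ideal R f) = R" "f \<in> poly_ring R" unfolding N_t_def by auto
  have "\<exists>i. coeff f i \<notin> M" if M: "M \<in> t_Max R" for M
  proof (rule ccontr)
    assume "\<not> ?thesis"
    then have "range (coeff f) \<subseteq> M" by auto
    moreover have sM: "submod R M" using dom_primeD(1)[OF t_Max_prime[OF R M]] .
    ultimately have "content_ideal R f \<subseteq> M"
      unfolding content_ideal_def using generated_subset_iff[OF R] by blast
    then have "R \<subseteq> M" using t_op_subset_t_ideal[OF t_Max_t_ideal[OF M]] c(1) by blast
    then show False using dom_primeD(4)[OF t_Max_prime[OF R M]] is_subringD(2)[OF R] by blast
  qed
  then show "f \<in> poly_ring R \<and> (\<forall>M\<in>t_Max R. \<exists>i. coeff f i \<notin> M)" using c(2) by blast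
next
  assume h: "f \<in> poly_ring R \<and> (\<forall>M\<in>t_Max R. \<exists>i. coeff f i \<notin> M)"
  have sup: "range (coeff f) \<subseteq> content_ideal R f"
    unfolding content_ideal_def by (rule generated_superset[OF R])
  have "content_ideal R f \<subseteq> R"
    unfolding content_ideal_def generated_subset_iff[OF R submod_subring[OF R]]
    using h poly_ring_coeff by blast
  then have id: "dom_ideal R (content_ideal R f)"
    unfolding dom_ideal_iff_submod content_ideal_def using submod_generated[OF R] by blast
  have ne: "content_ideal R f \<noteq> {0}"
    using sup range_coeff_subset_zero_iff[of f] f by blast
  have "t_op R (content_ideal R f) = R"
  proof (rule ccontr)
    assume "t_op R (content_ideal R f) \<noteq> R"
    then obtain M where M: "M \<in> t_Max R" "content_ideal R f \<subseteq> M"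
      by (rule proper_t_ideal_in_t_Max[OF R id ne])
    then show False using h sup by blast
  qed
  then show "f \<in> N_t R" unfolding N_t_def using h by simp
qed

text \<open>Multiplication by \<open>w\<close> maps the content of \<open>g\<close> into
  \<open>R\<close>. Since \<open>1\<close> lies in the v-closure of some finitely generated part of
  this content, it maps \<open>1\<close> into \<open>R\<close> too.\<close>

lemma N_t_cancel:
  assumes R: "is_subring R" and g: "g \<in> N_t R" and w: "\<And>i. w * coeff g i \<in> R"
  shows "w \<in> R"
proof -
  have "1 \<in> t_op R (content_ideal R g)" using g is_subringD(2)[OF R] unfolding N_t_def by simp
  then obtain J where J: "J \<subseteq> content_ideal R g" "1 \<in> v_op R J" unfolding t_op_def by blast
  have "w \<in> colon R (content_ideal R g)"
    unfolding content_ideal_def colon_generated[OF R] using w unfolding colon_def by auto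
  then have "w \<in> colon R J" using J(1) unfolding colon_def by blast
  then have "1 * w \<in> R" using J(2) unfolding v_op_def by (subst (asm) (2) colon_def) blast
  then show ?thesis by simp
qed

lemma N_t_subset: "N_t R \<subseteq> poly_ring R"
  unfolding N_t_def by blast

lemma poly_ring_closed:
  assumes R: "is_subring R" and fg: "f \<in> poly_ring R" "g \<in> poly_ring R"
  shows "f + g \<in> poly_ring R" "f - g \<in> poly_ring R" "f * g \<in> poly_ring R"
proof -
  show "f + g \<in> poly_ring R" "f - g \<in> poly_ring R"
    using fg is_subringD(3,4)[OF R] unfolding poly_ring_def by auto
  show "f * g \<in> poly_ring R"
    by (intro poly_ring_mult[OF R] is_subringD(5)[OF R] poly_ring_coeff fg)
qed

lemma t_Nagata_iff:
  "z \<in> t_Nagata R \<longleftrightarrow> (\<exists>f g. f \<in> poly_ring R \<and> g \<in> N_t R \<and> z = to_fract f / to_fract g)"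
  unfolding t_Nagata_def by (auto simp: Fract_conv_to_fract)

lemma t_NagataI: "f \<in> poly_ring R \<Longrightarrow> g \<in> N_t R \<Longrightarrow> to_fract f / to_fract g \<in> t_Nagata R"
  unfolding t_Nagata_iff by blast

section \<open>Verification of the content axioms for the t-Nagata ring\<close>

context
  fixes R :: "'k::field set"
  assumes subring: "is_subring R" and fractions: "\<forall>x. \<exists>a\<in>R. \<exists>b\<in>R. b \<noteq> 0 \<and> x = a / b"
    and PvMD: "PvMD R"
begin

text \<open>Gauss' lemma at each maximal t-ideal. The conditions concern products of coefficients
  only, so that \<open>h\<close> may be a cofactor with coefficients outside
  \<open>R\<close>.\<close>

lemma mult_in_N_t:
  assumes fh: "f \<noteq> 0" "h \<noteq> 0" "\<And>i j. coeff f i * coeff h j \<in> R"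
    and M: "\<And>M. M \<in> t_Max R \<Longrightarrow> \<exists>i j. coeff f i * coeff h j \<notin> M"
  shows "f * h \<in> N_t R"
proof -
  have "\<exists>n. coeff (f * h) n \<notin> M" if m: "M \<in> t_Max R" for M
  proof -
    obtain i j where "coeff f i * coeff h j \<notin> M" using M[OF m] by blast
    moreover have "valuation_dom (loc R M)" using PvMD m unfolding PvMD_def by blast
    ultimately show ?thesis
      using gauss_lemma[OF subring t_Max_prime[OF subring m] _ fh(3)] by metis
  qed
  moreover have "f * h \<in> poly_ring R" by (rule poly_ring_mult[OF subring fh(3)])
  moreover have "f * h \<noteq> 0" using fh by simp
  ultimately show ?thesis using N_t_iff[OF subring] by blast
qed

lemma N_t_mult:
  assumes "f \<in> N_t R" "h \<in> N_t R"
  shows "f * h \<in> N_t R"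
proof -
  have nz: "f \<noteq> 0" "h \<noteq> 0" using assms zero_notin_N_t[OF subring] by auto
  note f = assms(1)[unfolded N_t_iff[OF subring nz(1)]] and h = assms(2)[unfolded N_t_iff[OF subring nz(2)]]
  have R: "coeff f i \<in> R" "coeff h i \<in> R" for i
    by (rule poly_ring_coeff; use f h in simp)+
  show ?thesis
  proof (rule mult_in_N_t[OF nz])
    show "coeff f i * coeff h j \<in> R" for i j
      by (rule is_subringD(5)[OF subring R])
    fix M assume M: "M \<in> t_Max R"
    obtain i where i: "coeff f i \<notin> M" using f M by blast
    obtain j where j: "coeff h j \<notin> M" using h M by blast
    have "coeff f i * coeff h j \<notin> M"
      using dom_primeD(3)[OF t_Max_prime[OF subring M] R] i j by blast
    then show "\<exists>i j. coeff f i * coeff h j \<notin> M" by blast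
  qed
qed

text \<open>In a PvMD the finitely generated ideal \<open>c(f)\<close> is t-invertible; the coefficients of \<open>h\<close> are
  the elements of the inverse that witness this.\<close>

lemma content_inverse:
  assumes "f \<noteq> 0"
  obtains h where "\<forall>i j. coeff f i * coeff h j \<in> R" "f * h \<in> N_t R"
proof -
  note R = subring
  let ?S = "range (coeff f)"
  let ?A = "mod_prod (colon R ?S) ?S"
  have S: "finite ?S" "\<not> ?S \<subseteq> {0}" using finite_range_coeff range_coeff_subset_zero_iff assms by auto
  have sA: "submod R ?A" by (rule submod_mod_prod[OF submod_colon[OF R]])
  have AR: "?A \<subseteq> R" by (rule mod_prod_least[OF submod_subring[OF R]]) (auto simp: colon_def)
  \<comment> \<open>Divide by a coefficient \<open>a\<close> of minimal value and clear the
    denominators of all quotients by some \<open>t \<notin> P\<close>. Then \<open>t / a\<close>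
    lies in the inverse, and its product with \<open>a\<close> is \<open>t\<close>.\<close>
  have witness: "\<exists>t. t \<in> ?A \<and> t \<notin> P" if P: "dom_prime R P" "valuation_dom (loc R P)" for P
  proof -
    obtain a where a: "a \<in> ?S" "a \<noteq> 0" "\<forall>s\<in>?S. s / a \<in> loc R P"
      by (rule valuation_dominating_element[OF is_subring_loc[OF R P(1)] P(2) S])
    have "(\<lambda>s. s / a) ` ?S \<subseteq> loc R P" using a(3) by blast
    then obtain t where t: "t \<in> R" "t \<notin> P" "\<forall>s\<in>(\<lambda>s. s / a) ` ?S. t * s \<in> R"
      by (rule loc_common_denominator[OF R P(1) finite_imageI[OF S(1)]])
    have "t / a \<in> colon R ?S" using t(3) unfolding colon_def by auto
    then have "t / a * a \<in> ?A" using a(1) by (rule mod_prodI)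
    then show ?thesis using a(2) t(2) by auto
  qed
  \<comment> \<open>At the zero prime the localization is the whole field, trivially a valuation
    ring, so the same argument yields a nonzero element of \<open>?A\<close>.\<close>
  have "dom_prime R {0}"
    unfolding dom_prime_def dom_ideal_def using is_subringD(1,2)[OF R] by auto
  moreover have "loc R {0} = UNIV"
    using fractions unfolding loc_def by fastforce
  ultimately have "\<exists>t. t \<in> ?A \<and> t \<notin> {0}" by (intro witness) (auto simp: valuation_dom_def)
  then have ne: "?A \<noteq> {0}" by blast
  have id: "dom_ideal R ?A" using sA AR by (simp add: dom_ideal_iff_submod)
  have "t_op R ?A = R"
  proof (rule ccontr)
    assume "t_op R ?A \<noteq> R"
    then obtain M where M: "M \<in> t_Max R" "?A \<subseteq> M"
      by (rule proper_t_ideal_in_t_Max[OF R id ne])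
    have "valuation_dom (loc R M)" using PvMD M(1) unfolding PvMD_def by blast
    then show False using witness[OF t_Max_prime[OF R M(1)]] M(2) by blast
  qed
  then have "1 \<in> t_op R ?A" using is_subringD(2)[OF R] by simp
  then obtain F where F: "finite F" "F \<subseteq> ?A" "\<not> F \<subseteq> {0}" "1 \<in> v_op R F"
    unfolding mem_t_op_iff[OF R sA] by (elim exE conjE)
  obtain B where B: "finite B" "B \<subseteq> colon R ?S" "F \<subseteq> mod_prod B ?S"
    by (rule mod_prod_finite_left[OF F(1,2)])
  obtain h :: "'k poly" where h: "range (coeff h) = insert 0 B" by (rule poly_with_coeffs[OF B(1)])
  have inR: "coeff f i * coeff h j \<in> R" for i j
  proof -
    have "coeff h j = 0 \<or> coeff h j \<in> colon R ?S" using h B(2) by blast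
    then show ?thesis using is_subringD(1)[OF R] unfolding colon_def by (auto simp: mult.commute)
  qed
  \<comment> \<open>Stated for submodules so that it covers both the zero module, giving
    \<open>h \<noteq> 0\<close>, and the maximal t-ideals.\<close>
  have outside: "\<exists>i j. coeff f i * coeff h j \<notin> M" if sM: "submod R M" and nF: "\<not> F \<subseteq> M" for M
  proof (rule ccontr)
    assume no: "\<not> ?thesis"
    have "b * s \<in> M" if "b \<in> B" "s \<in> ?S" for b s
    proof -
      have "b \<in> range (coeff h)" using h that(1) by blast
      then obtain j where "b = coeff h j" by blast
      moreover obtain i where "s = coeff f i" using \<open>s \<in> ?S\<close> by blast
      ultimately show ?thesis using no by (simp add: mult.commute)
    qed
    then have "mod_prod B ?S \<subseteq> M" by (rule mod_prod_least[OF sM])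
    then show False using B(3) nF by blast
  qed
  have "submod R {0}" unfolding submod_def by auto
  then have "h \<noteq> 0" using outside[OF _ F(3)] by auto
  then have "f * h \<in> N_t R"
  proof (rule mult_in_N_t[OF assms _ inR])
    fix M assume M: "M \<in> t_Max R"
    have pM: "dom_prime R M" by (rule t_Max_prime[OF R M])
    have "\<not> F \<subseteq> M"
    proof
      assume "F \<subseteq> M"
      then have "1 \<in> t_op R M"
        unfolding mem_t_op_iff[OF R dom_primeD(1)[OF pM]] using F by blast
      then show False using t_Max_t_ideal[OF M] dom_primeD(4)[OF pM] unfolding t_ideal_def by simp
    qed
    then show "\<exists>i j. coeff f i * coeff h j \<notin> M" by (rule outside[OF dom_primeD(1)[OF pM]])
  qed
  then show ?thesis using that inR by blast
qed

lemma one_in_N_t: "1 \<in> N_t R"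
proof -
  have "coeff 1 0 \<notin> M" if "M \<in> t_Max R" for M
    using dom_primeD(4)[OF t_Max_prime[OF subring that]] by simp
  moreover have "(1::'k poly) \<in> poly_ring R"
    unfolding poly_ring_def using is_subringD(1,2)[OF subring] by (auto simp: coeff_1)
  ultimately show ?thesis unfolding N_t_iff[OF subring one_neq_zero] by blast
qed

lemma to_fract_in_t_Nagata: "f \<in> poly_ring R \<Longrightarrow> to_fract f \<in> t_Nagata R"
  using t_NagataI[OF _ one_in_N_t] by simp

lemma is_subring_t_Nagata: "is_subring (t_Nagata R)"
  unfolding is_subring_def
proof (intro conjI ballI)
  have "0 \<in> poly_ring R" "1 \<in> poly_ring R"
    using is_subringD(1)[OF subring] one_in_N_t N_t_subset by (simp add: poly_ring_def, blast)
  then show "0 \<in> t_Nagata R" "1 \<in> t_Nagata R"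
    using to_fract_in_t_Nagata[of 0] to_fract_in_t_Nagata[of 1] by simp_all
  fix x y assume xy: "x \<in> t_Nagata R" "y \<in> t_Nagata R"
  obtain f g where x: "f \<in> poly_ring R" "g \<in> N_t R" "x = to_fract f / to_fract g"
    using xy(1) unfolding t_Nagata_iff by blast
  obtain f' g' where y: "f' \<in> poly_ring R" "g' \<in> N_t R" "y = to_fract f' / to_fract g'"
    using xy(2) unfolding t_Nagata_iff by blast
  have nz: "g \<noteq> 0" "g' \<noteq> 0" using x(2) y(2) zero_notin_N_t[OF subring] by auto
  have gg: "g * g' \<in> N_t R" by (rule N_t_mult[OF x(2) y(2)])
  have pr: "g \<in> poly_ring R" "g' \<in> poly_ring R" using x(2) y(2) N_t_subset by auto
  note pr = poly_ring_closed(3)[OF subring x(1) pr(2)] poly_ring_closed(3)[OF subring y(1) pr(1)] poly_ring_closed(3)[OF subring x(1) y(1)]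
  have "x + y = to_fract (f * g' + f' * g) / to_fract (g * g')"
    "x - y = to_fract (f * g' - f' * g) / to_fract (g * g')"
    "x * y = to_fract (f * f') / to_fract (g * g')"
    unfolding x(3) y(3) using nz by (simp_all add: add_frac_eq diff_frac_eq)
  then show "x + y \<in> t_Nagata R" "x - y \<in> t_Nagata R" "x * y \<in> t_Nagata R"
    using t_NagataI[OF poly_ring_closed(1)[OF subring pr(1,2)] gg]
      t_NagataI[OF poly_ring_closed(2)[OF subring pr(1,2)] gg] t_NagataI[OF pr(3) gg] by simp_all
qed

lemma principal_eq_content:
  "mod_prod (t_Nagata R) {to_fract p} = mod_prod (t_Nagata R) ((\<lambda>x. to_fract [:x:]) ` range (coeff p))"
proof
  note D = is_subring_t_Nagata
  let ?N = "mod_prod (t_Nagata R) ((\<lambda>x. to_fract [:x:]) ` range (coeff p))"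
  have sN: "submod (t_Nagata R) ?N" by (rule submod_generated[OF D])
  have "to_fract (\<Sum>i\<in>I. monom (coeff p i) i) \<in> ?N" if "finite I" for I
    using that
  proof (induction I rule: finite_induct)
    case empty
    then show ?case using submodD(1)[OF sN] by simp
  next
    case (insert i I)
    have "to_fract (monom 1 i) \<in> t_Nagata R"
      by (rule to_fract_in_t_Nagata) (use is_subringD(1,2)[OF subring] in \<open>auto simp: poly_ring_def\<close>)
    then have "to_fract (monom 1 i) * to_fract [:coeff p i:] \<in> ?N"
      by (rule mod_prodI) simp
    moreover have "monom (coeff p i) i = monom 1 i * [:coeff p i:]"
      by (simp add: smult_monom)
    ultimately have "to_fract (monom (coeff p i) i) \<in> ?N" by (simp only: to_fract_mult)
    then show ?case using insert submodD(2)[OF sN] by simp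
  qed
  from this[of "{..degree p}"] have "to_fract p \<in> ?N"
    by (simp add: poly_as_sum_of_monoms)
  then show "mod_prod (t_Nagata R) {to_fract p} \<subseteq> ?N"
    using generated_subset_iff[OF D sN] by simp
  have sp: "submod (t_Nagata R) (mod_prod (t_Nagata R) {to_fract p})" by (rule submod_generated[OF D])
  have "to_fract [:coeff p i:] \<in> mod_prod (t_Nagata R) {to_fract p}" for i
  proof (cases "p = 0")
    case True
    then show ?thesis using mod_prod_zero by simp
  next
    case False
    \<comment> \<open>The coefficient \<open>p_i\<close> equals \<open>(p_i h) / (p h)\<close> times
      \<open>p\<close>, where \<open>p_i h\<close> is a polynomial over \<open>R\<close> and
      \<open>p h\<close> an admissible denominator.\<close>
    obtain h where h: "\<forall>i j. coeff p i * coeff h j \<in> R" "p * h \<in> N_t R" by (rule content_inverse[OF False])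
    have "smult (coeff p i) h \<in> poly_ring R" using h(1) unfolding poly_ring_def by simp
    then have "to_fract (smult (coeff p i) h) / to_fract (p * h) * to_fract p \<in> mod_prod (t_Nagata R) {to_fract p}"
      by (intro mod_prodI t_NagataI h(2)) auto
    moreover have "p * h \<noteq> 0" using h(2) zero_notin_N_t[OF subring] by auto
    then have "h \<noteq> 0" by auto
    have "smult (coeff p i) h = [:coeff p i:] * h" by simp
    then have "to_fract (smult (coeff p i) h) / to_fract (p * h) * to_fract p = to_fract [:coeff p i:]"
      using False \<open>h \<noteq> 0\<close> by (simp only: to_fract_mult) (simp add: field_simps)
    ultimately show ?thesis by simp
  qed
  then show "?N \<subseteq> mod_prod (t_Nagata R) {to_fract p}"
    unfolding generated_subset_iff[OF D sp] by blast
qed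

lemma generated_coeffs:
  assumes "range (coeff p) = insert 0 S"
  shows "mod_prod (t_Nagata R) ((\<lambda>x. to_fract [:x:]) ` S) = mod_prod (t_Nagata R) {to_fract p}"
  unfolding principal_eq_content assms
  using generated_insert_zero[OF is_subring_t_Nagata, of "(\<lambda>x. to_fract [:x:]) ` S"] by simp

text \<open>Let \<open>p\<close> have coefficient set \<open>insert 0 S\<close>. If
  \<open>x g = f p\<close> with \<open>f\<close> over \<open>R\<close> and \<open>g\<close> in
  \<open>N_t\<close>, any \<open>y\<close> in the inverse of \<open>S\<close> gives
  \<open>x y g = f (y p)\<close> over \<open>R\<close>, and \<open>N_t_cancel\<close> yields
  \<open>x y \<in> R\<close>. Conversely, the cofactor \<open>h\<close> of \<open>p\<close> has
  coefficients in this inverse, so \<open>x h\<close> is over \<open>R\<close> and \<open>x\<close>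
  is \<open>(x h) / (p h)\<close> times \<open>p\<close>.\<close>

lemma contraction_eq_v_op:
  assumes S: "finite S" "\<not> S \<subseteq> {0}"
  shows "to_fract [:x:] \<in> mod_prod (t_Nagata R) ((\<lambda>x. to_fract [:x:]) ` S) \<longleftrightarrow> x \<in> v_op R S"
proof
  obtain p :: "'k poly" where p: "range (coeff p) = insert 0 S" by (rule poly_with_coeffs[OF S(1)])
  have "p \<noteq> 0" using range_coeff_subset_zero_iff[of p] p S(2) by auto
  note gen = generated_coeffs[OF p] generated_singleton[OF is_subring_t_Nagata]
  show "x \<in> v_op R S" if "to_fract [:x:] \<in> mod_prod (t_Nagata R) ((\<lambda>x. to_fract [:x:]) ` S)"
  proof -
    obtain d where d: "d \<in> t_Nagata R" "to_fract [:x:] = d * to_fract p"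
      using \<open>to_fract [:x:] \<in> _\<close> unfolding gen by blast
    obtain f g where fg: "f \<in> poly_ring R" "g \<in> N_t R" "d = to_fract f / to_fract g"
      using d(1) unfolding t_Nagata_iff by blast
    have "g \<noteq> 0" using fg(2) zero_notin_N_t[OF subring] by auto
    then have "to_fract ([:x:] * g) = to_fract (f * p)"
      using d(2) fg(3) by (simp only: to_fract_mult) (simp add: field_simps)
    then have xg: "smult x g = f * p" by (simp only: to_fract_eq_iff) simp
    have "x * y \<in> R" if y: "y \<in> colon R S" for y
    proof (rule N_t_cancel[OF subring fg(2)])
      fix i
      have "y * coeff p j \<in> R" for j
      proof -
        have "coeff p j = 0 \<or> coeff p j \<in> S" using p by blast
        then show ?thesis using y is_subringD(1)[OF subring] unfolding colon_def by auto
      qed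
      then have "smult y p \<in> poly_ring R" unfolding poly_ring_def by simp
      then have "f * smult y p \<in> poly_ring R" by (rule poly_ring_closed(3)[OF subring fg(1)])
      then have "coeff (f * smult y p) i \<in> R" by (rule poly_ring_coeff)
      also have "f * smult y p = smult y (smult x g)" unfolding xg by simp
      finally show "x * y * coeff g i \<in> R" by (simp add: ac_simps)
    qed
    then show ?thesis unfolding v_op_def by (subst colon_def) blast
  qed
  show "to_fract [:x:] \<in> mod_prod (t_Nagata R) ((\<lambda>x. to_fract [:x:]) ` S)" if x: "x \<in> v_op R S"
  proof -
    obtain h where h: "\<forall>i j. coeff p i * coeff h j \<in> R" "p * h \<in> N_t R"
      by (rule content_inverse[OF \<open>p \<noteq> 0\<close>])
    have "coeff h j \<in> colon R S" for j
    proof -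
      have "coeff h j * s \<in> R" if "s \<in> S" for s
      proof -
        have "s \<in> range (coeff p)" using p that by blast
        then show ?thesis using h(1)[rule_format, of _ j] by (auto simp: mult.commute)
      qed
      then show ?thesis unfolding colon_def by blast
    qed
    then have "x * coeff h j \<in> R" for j
      using x unfolding v_op_def by (subst (asm) (2) colon_def) blast
    then have xh: "smult x h \<in> poly_ring R" unfolding poly_ring_def by simp
    have "p * h \<noteq> 0" using h(2) zero_notin_N_t[OF subring] by auto
    then have "h \<noteq> 0" by auto
    have "smult x h = [:x:] * h" by simp
    then have "to_fract [:x:] = to_fract (smult x h) / to_fract (p * h) * to_fract p"
      using \<open>p \<noteq> 0\<close> \<open>h \<noteq> 0\<close> by (simp only: to_fract_mult) (simp add: field_simps)
    also have "\<dots> \<in> mod_prod (t_Nagata R) {to_fract p}"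
      by (intro mod_prodI t_NagataI h(2) xh) simp
    finally show ?thesis unfolding gen(1) .
  qed
qed

text \<open>Expanding \<open>f / g\<close> by the cofactor \<open>h\<close> of the denominator makes
  the new denominator \<open>g * h\<close> a unit of the t-Nagata ring. Hence the element generates
  the same module as the polynomial \<open>f * h\<close>, whose coefficients can be used.\<close>

lemma principal_generated_by_constants:
  "\<exists>S. finite S \<and> mod_prod (t_Nagata R) {z} = mod_prod (t_Nagata R) ((\<lambda>x. to_fract [:x:]) ` S)"
proof -
  note D = is_subring_t_Nagata
  obtain f g where fg: "z = Fract f g" "g \<noteq> 0" by (cases z)
  obtain h where h: "g * h \<in> N_t R" by (rule content_inverse[OF fg(2)])
  have gh: "g * h \<noteq> 0" using h zero_notin_N_t[OF subring] by auto
  have z: "to_fract (f * h) = to_fract (g * h) * z"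
    using fg gh by (simp add: Fract_conv_to_fract)
  have "to_fract (g * h) \<in> t_Nagata R" using to_fract_in_t_Nagata h N_t_subset by blast
  then have 1: "to_fract (f * h) \<in> mod_prod (t_Nagata R) {z}" unfolding z by (intro mod_prodI) auto
  have "to_fract 1 / to_fract (g * h) \<in> t_Nagata R"
    using one_in_N_t N_t_subset by (intro t_NagataI h) blast
  then have "to_fract 1 / to_fract (g * h) * to_fract (f * h) \<in> mod_prod (t_Nagata R) {to_fract (f * h)}"
    by (intro mod_prodI) auto
  then have 2: "z \<in> mod_prod (t_Nagata R) {to_fract (f * h)}" unfolding z using gh by simp
  have "mod_prod (t_Nagata R) {z} = mod_prod (t_Nagata R) {to_fract (f * h)}"
  proof
    show "mod_prod (t_Nagata R) {z} \<subseteq> mod_prod (t_Nagata R) {to_fract (f * h)}"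
      unfolding generated_subset_iff[OF D submod_generated[OF D]] using 2 by simp
    show "mod_prod (t_Nagata R) {to_fract (f * h)} \<subseteq> mod_prod (t_Nagata R) {z}"
      unfolding generated_subset_iff[OF D submod_generated[OF D]] using 1 by simp
  qed
  then show ?thesis unfolding principal_eq_content using finite_range_coeff by blast
qed

lemma content_extension_t_Nagata: "content_extension (\<lambda>x. to_fract [:x:]) R (t_Nagata R)"
proof
  show "to_fract [:x + y:] = to_fract [:x:] + to_fract [:y:]" for x y :: 'k
    by (simp flip: to_fract_add)
  show "to_fract [:x * y:] = to_fract [:x:] * to_fract [:y:]" for x y :: 'k
    by (simp flip: to_fract_mult)
  show "to_fract [:1::'k:] = 1"
    by (simp flip: one_pCons)
  show "\<exists>z. mod_prod (t_Nagata R) ((\<lambda>x. to_fract [:x:]) ` S) = mod_prod (t_Nagata R) {z}" if "finite S" for S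
    using poly_with_coeffs[OF that] generated_coeffs by metis
qed (fact subring is_subring_t_Nagata principal_generated_by_constants contraction_eq_v_op)+

end

theorem theorem1p18:
  fixes R :: "'k::field set"
  assumes "is_domain_of R" and "R \<noteq> UNIV" and "PvMD R"
  shows "(t_sharp R \<longleftrightarrow> sharp_domain (t_Nagata R))
       \<and> (t_sharp_sharp R \<longleftrightarrow> sharp_sharp_domain (t_Nagata R))
       \<and> (tRTP_domain R \<longleftrightarrow> RTP_domain (t_Nagata R))"
proof -
  interpret content_extension "\<lambda>x. to_fract [:x:]" R "t_Nagata R"
    using assms(1,3) unfolding is_domain_of_def by (intro content_extension_t_Nagata) auto
  show ?thesis
    using t_sharp_iff_sharp[OF assms(1,2)] t_sharp_sharp_iff_sharp_sharp tRTP_iff_RTP by blast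
qed

end
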